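(* If $K$ is a compact operator on a locally convex (or, more generally, locally pseudo-convex) space, then $r(K)=|\sigma(K)|$.
   Context: Spaces are over $\mathbb{C}$. Locally convex spaces are Hausdorff by definition. A set $A$ is pseudo-convex if $A+A\subseteq\alpha A$ for some number $\alpha$; a Hausdorff topological vector space is locally pseudo-convex if it has a base of pseudo-convex zero neighborhoods. A linear operator $K$ on $X$ is compact if it maps some zero neighborhood into a precompact set, where a set is called precompact if its closure is compact. Every compact operator is nb-bounded (see below). Every base of zero neighborhoods that is mentioned is assumed to consist of balanced sets, to be closed under multiplication by nonzero scalars, and such that for members $V_1,V_2,V$ there are members $W\subseteq V_1\cap V_2$ and $U$ with $U+U\subseteq V$; in a locally convex space its members are also assumed convex. A linear operator $T$ is bb-bounded if it maps bounded sets to bounded sets; nn-bounded if there is a base $\mathcal{N}_0$ of zero neighborhoods such that for every $U\in\mathcal{N}_0$ there is $\alpha>0$ with $T(U)\subseteq\alpha U$; nb-bounded if it maps some zero neighborhood into a bounded set. Spectra: $\rho^{bb}(T)$ (resp. $\rho^{c}(T)$, $\rho^{nn}(T)$) is the set of $\lambda\in\mathbb{C}$ such that $\lambda I-T$ has a two-sided inverse that is bb-bounded (resp. continuous, nn-bounded); $\rho^{nb}(T)$ is the set of $\lambda\in\mathbb{C}$ such that $\lambda I-T$ has a two-sided inverse of the form $\alpha I+S$ with $\alpha$ a scalar and $S$ nb-bounded. $\sigma^{bb}(T),\sigma^{c}(T),\sigma^{nn}(T),\sigma^{nb}(T)$ are their complements in $\mathbb{C}$. Spectral radii: $r_{bb}(T)$,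 $r_c(T)$, $r_{nn}(T)$, $r_{nb}(T)$ are the infima of those $\nu>0$ for which $T^n/\nu^n\to0$, respectively: uniformly on every bounded set; equicontinuously (for every zero neighborhood $V$ there is a zero neighborhood $U$ such that for all $\varepsilon>0$, $\frac{T^n}{\nu^n}(U)\subseteq\varepsilon V$ for all large $n$); in the nn-sense (there is a base $\mathcal{N}_0$ of zero neighborhoods such that for every $U\in\mathcal{N}_0$, $\varepsilon>0$: $\frac{T^n}{\nu^n}(U)\subseteq\varepsilon U$ for all large $n$); uniformly on some zero neighborhood. Here $\inf\emptyset=\infty$. For an nb-bounded operator $T$ one has $\sigma^{bb}(T)=\sigma^c(T)=\sigma^{nn}(T)=\sigma^{nb}(T)$ and $r_{bb}(T)=r_c(T)=r_{nn}(T)=r_{nb}(T)$; the common values are denoted $\sigma(T)$ and $r(T)$. Also $|\sigma(T)|=\sup\{|\lambda| : \lambda\in\sigma(T)\}$, with $\sup\emptyset=0$. *)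

theory Defs
  imports "HOL-Analysis.Analysis"
begin

section \<open>Complex topological vector spaces\<close>

text \<open>
  Building on \<^class>\<open>real_vector\<close>, with real scalars acting as the corresponding complex ones,
  makes the library notions \<^const>\<open>convex\<close> and \<^const>\<open>scaleR\<close> available.
\<close>

class scaleC =
  fixes scaleC :: "complex \<Rightarrow> 'a \<Rightarrow> 'a" (infixr \<open>*\<^sub>C\<close> 75)

class complex_vector = real_vector + scaleC +
  assumes scaleC_add_right: "a *\<^sub>C (x + y) = a *\<^sub>C x + a *\<^sub>C y"
    and scaleC_add_left: "(a + b) *\<^sub>C x = a *\<^sub>C x + b *\<^sub>C x"
    and scaleC_scaleC: "a *\<^sub>C b *\<^sub>C x = (a * b) *\<^sub>C x"
    and scaleC_one: "1 *\<^sub>C x = x"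
    and scaleR_scaleC: "r *\<^sub>R x = complex_of_real r *\<^sub>C x"

text \<open>Hausdorff complex topological vector spaces; the axiom is joint continuity of scaling.\<close>

class complex_tvs = complex_vector + topological_ab_group_add + t2_space +
  assumes tendsto_scaleC_Pair:
    "LIM p (nhds a \<times>\<^sub>F nhds x). fst p *\<^sub>C snd p :> nhds (a *\<^sub>C x)"

abbreviation clinear :: "('a::complex_vector \<Rightarrow> 'b::complex_vector) \<Rightarrow> bool"
  where "clinear \<equiv> Vector_Spaces.linear scaleC scaleC"

definition zero_nbhd :: "'a::complex_tvs set \<Rightarrow> bool"
  where "zero_nbhd U \<longleftrightarrow> 0 \<in> interior U"

definition cbalanced :: "'a::complex_vector set \<Rightarrow> bool"
  where "cbalanced U \<longleftrightarrow> (\<forall>c. cmod c \<le> 1 \<longrightarrow> (\<lambda>x. c *\<^sub>C x) ` U \<subseteq> U)"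

definition tvs_bounded :: "'a::complex_tvs set \<Rightarrow> bool"
  where "tvs_bounded A \<longleftrightarrow>
    (\<forall>V. zero_nbhd V \<longrightarrow> (\<exists>\<alpha>::real. 0 < \<alpha> \<and> A \<subseteq> (\<lambda>x. \<alpha> *\<^sub>R x) ` V))"

section \<open>Bases of zero neighborhoods\<close>

text \<open>
  The standing requirements on a base of zero neighborhoods are split in two: the requirement
  that members be convex applies only in locally convex spaces, and so cannot take part in
  the definition of local convexity.
\<close>

definition zero_base_general :: "'a::complex_tvs set set \<Rightarrow> bool"
  where "zero_base_general N \<longleftrightarrow>
    (\<forall>U\<in>N. zero_nbhd U) \<and>
    (\<forall>V. zero_nbhd V \<longrightarrow> (\<exists>U\<in>N. U \<subseteq> V)) \<and>
    (\<forall>U\<in>N. cbalanced U) \<and>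
    (\<forall>U\<in>N. \<forall>c. c \<noteq> 0 \<longrightarrow> (\<lambda>x. c *\<^sub>C x) ` U \<in> N) \<and>
    (\<forall>V\<^sub>1\<in>N. \<forall>V\<^sub>2\<in>N. \<exists>W\<in>N. W \<subseteq> V\<^sub>1 \<inter> V\<^sub>2) \<and>
    (\<forall>V\<in>N. \<exists>U\<in>N. U + U \<subseteq> V)"

definition locally_convex :: "'a::complex_tvs itself \<Rightarrow> bool"
  where "locally_convex _ \<longleftrightarrow>
    (\<exists>N::'a set set. zero_base_general N \<and> (\<forall>U\<in>N. convex U))"

definition zero_base :: "'a::complex_tvs set set \<Rightarrow> bool"
  where "zero_base N \<longleftrightarrow>
    zero_base_general N \<and> (locally_convex TYPE('a) \<longrightarrow> (\<forall>U\<in>N. convex U))"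

definition pseudo_convex :: "'a::complex_vector set \<Rightarrow> bool"
  where "pseudo_convex A \<longleftrightarrow> (\<exists>\<alpha>::complex. A + A \<subseteq> (\<lambda>x. \<alpha> *\<^sub>C x) ` A)"

definition locally_pseudo_convex :: "'a::complex_tvs itself \<Rightarrow> bool"
  where "locally_pseudo_convex _ \<longleftrightarrow>
    (\<exists>N::'a set set. zero_base N \<and> (\<forall>U\<in>N. pseudo_convex U))"

section \<open>Classes of linear operators\<close>

definition compact_operator :: "('a::complex_tvs \<Rightarrow> 'a) \<Rightarrow> bool"
  where "compact_operator K \<longleftrightarrow>
    clinear K \<and> (\<exists>U. zero_nbhd U \<and> compact (closure (K ` U)))"

definition bb_bounded :: "('a::complex_tvs \<Rightarrow> 'a) \<Rightarrow> bool"
  where "bb_bounded T \<longleftrightarrow> clinear T \<and> (\<forall>A. tvs_bounded A \<longrightarrow> tvs_bounded (T ` A))"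

definition c_bounded :: "('a::complex_tvs \<Rightarrow> 'a) \<Rightarrow> bool"
  where "c_bounded T \<longleftrightarrow> clinear T \<and> continuous_on UNIV T"

definition nn_bounded :: "('a::complex_tvs \<Rightarrow> 'a) \<Rightarrow> bool"
  where "nn_bounded T \<longleftrightarrow>
    clinear T \<and>
    (\<exists>N. zero_base N \<and> (\<forall>U\<in>N. \<exists>\<alpha>::real. 0 < \<alpha> \<and> T ` U \<subseteq> (\<lambda>x. \<alpha> *\<^sub>R x) ` U))"

definition nb_bounded :: "('a::complex_tvs \<Rightarrow> 'a) \<Rightarrow> bool"
  where "nb_bounded T \<longleftrightarrow> clinear T \<and> (\<exists>U. zero_nbhd U \<and> tvs_bounded (T ` U))"

section \<open>Spectra\<close>

definition resolvent_at :: "('a::complex_tvs \<Rightarrow> 'a) \<Rightarrow> complex \<Rightarrow> ('a \<Rightarrow> 'a) \<Rightarrow> bool"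
  where "resolvent_at T l R \<longleftrightarrow>
    (\<forall>x. R (l *\<^sub>C x - T x) = x) \<and> (\<forall>x. l *\<^sub>C R x - T (R x) = x)"

definition spectrum_bb :: "('a::complex_tvs \<Rightarrow> 'a) \<Rightarrow> complex set"
  where "spectrum_bb T = - {l. \<exists>R. resolvent_at T l R \<and> bb_bounded R}"

definition spectrum_c :: "('a::complex_tvs \<Rightarrow> 'a) \<Rightarrow> complex set"
  where "spectrum_c T = - {l. \<exists>R. resolvent_at T l R \<and> c_bounded R}"

definition spectrum_nn :: "('a::complex_tvs \<Rightarrow> 'a) \<Rightarrow> complex set"
  where "spectrum_nn T = - {l. \<exists>R. resolvent_at T l R \<and> nn_bounded R}"

definition spectrum_nb :: "('a::complex_tvs \<Rightarrow> 'a) \<Rightarrow> complex set"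
  where "spectrum_nb T =
    - {l. \<exists>\<alpha> S. nb_bounded S \<and> resolvent_at T l (\<lambda>x. \<alpha> *\<^sub>C x + S x)}"

text \<open>In \<^typ>\<open>ennreal\<close> the supremum of the empty set is 0, as required.\<close>

definition spectral_modulus :: "complex set \<Rightarrow> ennreal"
  where "spectral_modulus S = (SUP l\<in>S. ennreal (cmod l))"

section \<open>Spectral radii\<close>

definition scaled_power :: "('a::complex_tvs \<Rightarrow> 'a) \<Rightarrow> real \<Rightarrow> nat \<Rightarrow> 'a \<Rightarrow> 'a"
  where "scaled_power T \<nu> n x = (1 / \<nu> ^ n) *\<^sub>R (T ^^ n) x"

text \<open>
  Each notion of convergence to the zero operator is a predicate on sequences of operators.
\<close>

definition null_uniformly_on :: "'a::complex_tvs set \<Rightarrow> (nat \<Rightarrow> 'a \<Rightarrow> 'a) \<Rightarrow> bool"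
  where "null_uniformly_on A S \<longleftrightarrow>
    (\<forall>V. zero_nbhd V \<longrightarrow> (\<forall>\<^sub>F n in sequentially. S n ` A \<subseteq> V))"

definition null_bb :: "(nat \<Rightarrow> 'a::complex_tvs \<Rightarrow> 'a) \<Rightarrow> bool"
  where "null_bb S \<longleftrightarrow> (\<forall>A. tvs_bounded A \<longrightarrow> null_uniformly_on A S)"

definition null_c :: "(nat \<Rightarrow> 'a::complex_tvs \<Rightarrow> 'a) \<Rightarrow> bool"
  where "null_c S \<longleftrightarrow>
    (\<forall>V. zero_nbhd V \<longrightarrow>
      (\<exists>U. zero_nbhd U \<and>
        (\<forall>\<epsilon>::real. 0 < \<epsilon> \<longrightarrow> (\<forall>\<^sub>F n in sequentially. S n ` U \<subseteq> (\<lambda>x. \<epsilon> *\<^sub>R x) ` V))))"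

definition null_nn :: "(nat \<Rightarrow> 'a::complex_tvs \<Rightarrow> 'a) \<Rightarrow> bool"
  where "null_nn S \<longleftrightarrow>
    (\<exists>N. zero_base N \<and>
      (\<forall>U\<in>N. \<forall>\<epsilon>::real. 0 < \<epsilon> \<longrightarrow>
        (\<forall>\<^sub>F n in sequentially. S n ` U \<subseteq> (\<lambda>x. \<epsilon> *\<^sub>R x) ` U)))"

definition null_nb :: "(nat \<Rightarrow> 'a::complex_tvs \<Rightarrow> 'a) \<Rightarrow> bool"
  where "null_nb S \<longleftrightarrow> (\<exists>U. zero_nbhd U \<and> null_uniformly_on U S)"

definition radius_wrt ::
    "((nat \<Rightarrow> 'a::complex_tvs \<Rightarrow> 'a) \<Rightarrow> bool) \<Rightarrow> ('a \<Rightarrow> 'a) \<Rightarrow> ennreal"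
  where "radius_wrt null T = Inf {ennreal \<nu> |\<nu>. 0 < \<nu> \<and> null (scaled_power T \<nu>)}"

definition radius_bb :: "('a::complex_tvs \<Rightarrow> 'a) \<Rightarrow> ennreal"
  where "radius_bb = radius_wrt null_bb"

definition radius_c :: "('a::complex_tvs \<Rightarrow> 'a) \<Rightarrow> ennreal"
  where "radius_c = radius_wrt null_c"

definition radius_nn :: "('a::complex_tvs \<Rightarrow> 'a) \<Rightarrow> ennreal"
  where "radius_nn = radius_wrt null_nn"

definition radius_nb :: "('a::complex_tvs \<Rightarrow> 'a) \<Rightarrow> ennreal"
  where "radius_nb = radius_wrt null_nb"

end

theory Submission
  imports Defs
begin

text \<open>
  Let \<open>q\<close> be the gauge of a balanced pseudo-convex zero neighborhood \<open>U\<close> such that \<open>K U\<close> is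
  relatively compact; it is a seminorm up to a constant in the triangle inequality. Riesz theory
  for \<open>q\<close>, which needs neither completeness nor local convexity, shows that a nonzero \<open>\<lambda>\<close> that
  is not an eigenvalue of \<open>K\<close> has a resolvent of the form \<open>\<lambda>\<^sup>-\<^sup>1 I + S\<close> with \<open>S\<close> nb-bounded. Hence all
  spectra agree with the set of eigenvalues up to the point \<open>0\<close>.

  An eigenvector with eigenvalue \<open>\<lambda>\<close> forces each radius to be at least \<open>\<bar>\<lambda>\<bar>\<close>. For the converse,
  scale so that \<open>(1 - zT)\<^sup>-\<^sup>1\<close> is \<open>q\<close>-bounded uniformly on the unit disc. Rickart's argument
  for the spectral radius formula averages \<open>(1 - zT)\<^sup>-\<^sup>1\<close> over \<open>N\<close>-th roots of unity, which yields
  \<open>(1 - s\<^sup>N T\<^sup>N)\<^sup>-\<^sup>1\<close>, and concludes by uniform continuity. Averaging is not uniformly bounded for a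
  quasi-seminorm, but it costs only a power of \<open>N\<close>, and a difference of sufficiently high order with
  step \<open>N\<^bsup>-1/2\<^esup>\<close> compensates this loss.
\<close>

section \<open>Quasi-seminorms and iterated differences\<close>

interpretation cvs: vector_space "scaleC :: complex \<Rightarrow> 'a::complex_vector \<Rightarrow> 'a"
  by unfold_locales (simp_all add: scaleC_add_right scaleC_add_left scaleC_scaleC scaleC_one)

lemma clinear_iff:
  "clinear f \<longleftrightarrow> (\<forall>x y. f (x + y) = f x + f y) \<and> (\<forall>c x. f (c *\<^sub>C x) = c *\<^sub>C f x)"
  unfolding Vector_Spaces.linear_iff
  by (simp add: cvs.vector_space_axioms)

lemma clinear_inverse:
  assumes "clinear S" "\<And>x. g (S x) = x" "\<And>x. S (g x) = x"
  shows "clinear g"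
  using assms unfolding clinear_iff by metis

lemma clinear_funpow:
  fixes T :: "'a::complex_vector \<Rightarrow> 'a"
  shows "clinear T \<Longrightarrow> clinear (T ^^ n)"
  by (induction n) (simp_all add: clinear_iff)

lemma sum_lessThan_add:
  fixes f :: "nat \<Rightarrow> 'a::comm_monoid_add"
  shows "(\<Sum>i<m + n. f i) = (\<Sum>i<m. f i) + (\<Sum>i<n. f (m + i))"
  by (induction n) (simp_all add: add.assoc)

text \<open>The gauge of a balanced pseudo-convex set satisfies a triangle inequality of this shape.
  With \<open>max\<close>, the constants multiply along the depth of a bracketing of a sum.\<close>

locale quasi_seminorm =
  fixes q :: "'a::complex_vector \<Rightarrow> real" and a :: real
  assumes a_ge_1: "1 \<le> a"
    and scale: "q (c *\<^sub>C x) = cmod c * q x"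
    and add: "q (x + y) \<le> a * max (q x) (q y)"
begin

lemma zero [simp]: "q 0 = 0"
  using scale[of 0 0] by simp

lemma minus [simp]: "q (- x) = q x"
  using scale[of "-1" x] by simp

lemma nonneg [simp]: "0 \<le> q x"
  using add[of x "- x"] a_ge_1 by (simp add: zero_le_mult_iff)

lemma add_le: "q x \<le> b \<Longrightarrow> q y \<le> b \<Longrightarrow> q (x + y) \<le> a * b"
  by (rule order_trans[OF add]) (use a_ge_1 in \<open>auto intro: mult_left_mono\<close>)

lemma diff_le: "q x \<le> b \<Longrightarrow> q y \<le> b \<Longrightarrow> q (x - y) \<le> a * b"
  using add_le[of x b "- y"] by simp

lemma add_less: "q x < b \<Longrightarrow> q y < b \<Longrightarrow> q (x + y) < a * b"
  by (rule order.strict_trans1[OF add]) (use a_ge_1 in auto)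

lemma diff_less: "q x < b \<Longrightarrow> q y < b \<Longrightarrow> q (x - y) < a * b"
  using add_less[of x b "- y"] by simp

lemma scaleR: "q (r *\<^sub>R x) = \<bar>r\<bar> * q x"
  by (simp add: scaleR_scaleC scale)

text \<open>Bracketing the sum as a binary tree of depth \<open>j\<close> costs one factor
  \<open>a\<close> per level, whereas adding one term after the other would cost one per
  term.\<close>

lemma sum_pow2_le:
  fixes f :: "nat \<Rightarrow> 'a"
  shows "(\<And>i. i < 2 ^ j \<Longrightarrow> q (f i) \<le> b) \<Longrightarrow> q (\<Sum>i<2 ^ j. f i) \<le> a ^ j * b"
proof (induction j arbitrary: f)
  case 0
  from this[of 0] show ?case by (simp add: lessThan_Suc)
next
  case (Suc j)
  have "(\<Sum>i<2 ^ Suc j. f i) = (\<Sum>i<2 ^ j. f i) + (\<Sum>i<2 ^ j. f (2 ^ j + i))"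
    using sum_lessThan_add[of f "2 ^ j" "2 ^ j"] by (simp add: mult_2)
  moreover have "q (\<Sum>i<2 ^ j. f i) \<le> a ^ j * b"
    by (rule Suc.IH) (use Suc.prems in auto)
  moreover have "q (\<Sum>i<2 ^ j. f (2 ^ j + i)) \<le> a ^ j * b"
    by (rule Suc.IH) (use Suc.prems in auto)
  ultimately show ?case
    using add_le by (simp add: mult.assoc)
qed

end

section \<open>Forward differences of sequences\<close>

definition fdiff :: "(nat \<Rightarrow> 'a::ab_group_add) \<Rightarrow> nat \<Rightarrow> 'a"
  where "fdiff u i = u (Suc i) - u i"

lemma funpow_Suc_fdiff: "(fdiff ^^ Suc m) u i = (fdiff ^^ m) u (Suc i) - (fdiff ^^ m) u i"
  by (simp add: fdiff_def)

lemma funpow_fdiff_sum: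
  "(fdiff ^^ m) (\<lambda>i. \<Sum>j\<in>J. f j i) = (\<lambda>i. \<Sum>j\<in>J. (fdiff ^^ m) (f j) i)"
  by (induction m) (simp_all add: fun_eq_iff fdiff_def sum_subtractf)

lemma funpow_fdiff_scaleC:
  fixes f :: "nat \<Rightarrow> 'a::complex_vector"
  shows "(fdiff ^^ m) (\<lambda>i. c *\<^sub>C f i) = (\<lambda>i. c *\<^sub>C (fdiff ^^ m) f i)"
  by (induction m) (simp_all add: fun_eq_iff fdiff_def cvs.scale_right_diff_distrib)

text \<open>Differences of positive order annihilate constants. In \<open>radius_step\<close> this
  allows averages to be replaced by their deviation from the identity.\<close>

lemma funpow_Suc_fdiff_shift:
  "(fdiff ^^ Suc m) (\<lambda>i. f i - c) = (fdiff ^^ Suc m) f"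
proof -
  have "fdiff (\<lambda>i. f i - c) = fdiff f"
    by (simp add: fun_eq_iff fdiff_def)
  then show ?thesis
    by (simp only: funpow_Suc_right comp_def)
qed

text \<open>Extrapolation: \<open>u m\<close> is recovered from its predecessors and the
  \<open>m\<close>-th difference. The induction passes to \<open>fdiff u\<close>, and each order
  costs \<open>a\<close> twice: once to bound \<open>fdiff u\<close>, once to add \<open>u m\<close>
  back to \<open>fdiff u m\<close>.\<close>

lemma (in quasi_seminorm) le_of_fdiff_le:
  "(\<And>i. i < m \<Longrightarrow> q (u i) \<le> \<delta>) \<Longrightarrow> q ((fdiff ^^ m) u 0) \<le> \<delta> \<Longrightarrow> q (u m) \<le> a ^ (2 * m) * \<delta>"
proof (induction m arbitrary: u \<delta>)
  case 0
  then show ?case by simp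
next
  case (Suc m)
  have "0 \<le> \<delta>"
    using Suc.prems(1)[of 0] nonneg[of "u 0"] by linarith
  then have \<delta>: "\<delta> \<le> a * \<delta>" "\<delta> \<le> a ^ (2 * m) * (a * \<delta>)"
    using a_ge_1 mult_right_mono[of 1 a \<delta>] mult_mono[of 1 "a ^ (2 * m)" \<delta> "a * \<delta>"]
    by simp_all
  have "q (fdiff u m) \<le> a ^ (2 * m) * (a * \<delta>)"
  proof (rule Suc.IH)
    show "q (fdiff u i) \<le> a * \<delta>" if "i < m" for i
      unfolding fdiff_def using that by (intro diff_le Suc.prems) auto
    show "q ((fdiff ^^ m) (fdiff u) 0) \<le> a * \<delta>"
      using Suc.prems(2) \<delta> by (simp only: funpow_Suc_right comp_def)
  qed
  then have "q (fdiff u m + u m) \<le> a * (a ^ (2 * m) * (a * \<delta>))"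
    using Suc.prems(1)[of m] \<delta>(2) by (intro add_le) auto
  then show ?case
    by (simp add: fdiff_def mult_ac)
qed

section \<open>Powers of an operator with bounded resolvent\<close>

text \<open>Here \<open>g z\<close> is the inverse of \<open>1 - z T\<close>, bounded uniformly on
  the closed unit disc. In the variable \<open>z\<close>, the inverse of the spectral parameter, the
  point at infinity becomes the center of the disc.\<close>

locale resolvent_family = quasi_seminorm q a + T: Vector_Spaces.linear scaleC scaleC T
  for q :: "'a::complex_vector \<Rightarrow> real" and a and T :: "'a \<Rightarrow> 'a" +
  fixes g :: "complex \<Rightarrow> 'a \<Rightarrow> 'a" and L M :: real
  assumes L_nonneg: "0 \<le> L" and M_nonneg: "0 \<le> M"
    and T_bound: "q (T x) \<le> L * q x"
    and g_left: "cmod z \<le> 1 \<Longrightarrow> g z (x - z *\<^sub>C T x) = x"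
    and g_right: "cmod z \<le> 1 \<Longrightarrow> g z x - z *\<^sub>C T (g z x) = x"
    and g_bound: "cmod z \<le> 1 \<Longrightarrow> q (g z x) \<le> M * q x"
begin

lemma g_eqI: "cmod z \<le> 1 \<Longrightarrow> x = y - z *\<^sub>C T y \<Longrightarrow> g z x = y"
  by (simp add: g_left)

lemma g_linear:
  assumes z: "cmod z \<le> 1"
  shows "clinear (g z)"
proof (rule clinear_inverse)
  show "clinear (\<lambda>x. x - z *\<^sub>C T x)"
    by (simp add: clinear_iff T.add T.scale cvs.scale_right_distrib cvs.scale_right_diff_distrib
        mult.commute)
qed (rule g_left[OF z] g_right[OF z])+

lemmas g_scale = g_linear[unfolded clinear_iff, THEN conjunct2, rule_format]

lemma g_diff:
  assumes z: "cmod z \<le> 1"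
  shows "g z (x - y) = g z x - g z y"
proof -
  interpret g: Vector_Spaces.linear scaleC scaleC "g z"
    by (rule g_linear[OF z])
  show ?thesis by (rule g.diff)
qed

lemma g_T:
  assumes z: "cmod z \<le> 1"
  shows "g z (T x) = T (g z x)"
  using arg_cong[OF g_right[OF z, of x], of T]
  by (intro g_eqI z) (simp add: T.scale T.diff)

lemma g_funpow: "cmod z \<le> 1 \<Longrightarrow> g z ((T ^^ n) x) = (T ^^ n) (g z x)"
  by (induction n) (simp_all add: g_T)

lemma g_commute:
  assumes z: "cmod z \<le> 1" and w: "cmod w \<le> 1"
  shows "g z (g w x) = g w (g z x)"
proof (rule sym, rule g_eqI[OF w])
  show "g z x = g z (g w x) - w *\<^sub>C T (g z (g w x))"
    using arg_cong[OF g_right[OF w, of x], of "g z"] by (simp add: g_diff g_scale g_T z)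
qed

section \<open>Differences of the resolvent along arithmetic progressions\<close>

lemma resolvent_identity:
  assumes z: "cmod z \<le> 1" and w: "cmod w \<le> 1"
  shows "g w x - g z x = (w - z) *\<^sub>C T (g z (g w x))"
proof -
  have "g z x = g z (g w x) - w *\<^sub>C T (g z (g w x))"
    using arg_cong[OF g_right[OF w, of x], of "g z"] by (simp add: g_diff g_scale g_T z)
  moreover have "g z (g w x) = g w x + z *\<^sub>C T (g z (g w x))"
    using g_right[OF z, of "g w x"] by (simp add: diff_eq_eq)
  ultimately have "g z x = g w x + z *\<^sub>C T (g z (g w x)) - w *\<^sub>C T (g z (g w x))"
    by (simp only:)
  then show ?thesis
    by (simp add: cvs.scale_left_diff_distrib)
qed

text \<open>The composition of the \<open>m + 1\<close> resolvents at \<open>p i\<close>, ...,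
  \<open>p (i + m)\<close>. Up to the factor \<open>T ^^ m\<close> this is the divided difference of
  the resolvent at these nodes.\<close>

primrec gprod :: "(nat \<Rightarrow> complex) \<Rightarrow> nat \<Rightarrow> nat \<Rightarrow> 'a \<Rightarrow> 'a" where
  "gprod p 0 i x = g (p i) x"
| "gprod p (Suc m) i x = g (p i) (gprod p m (Suc i) x)"

lemma gprod_last: "gprod p (Suc m) i x = gprod p m i (g (p (Suc (i + m))) x)"
  by (induction m arbitrary: i) auto

context
  fixes p :: "nat \<Rightarrow> complex" and n :: nat and z d :: complex
  assumes p_disc: "\<And>j. j \<le> n \<Longrightarrow> cmod (p j) \<le> 1"
    and p_arith: "\<And>j. p j = z + of_nat j * d"
begin

lemma gprod_g: "i + m \<le> n \<Longrightarrow> cmod w \<le> 1 \<Longrightarrow> gprod p m i (g w x) = g w (gprod p m i x)"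
  by (induction m arbitrary: i) (auto simp: g_commute p_disc)

lemma gprod_T: "i + m \<le> n \<Longrightarrow> gprod p m i (T x) = T (gprod p m i x)"
  by (induction m arbitrary: i) (auto simp: g_T p_disc)

lemma gprod_scale: "i + m \<le> n \<Longrightarrow> gprod p m i (c *\<^sub>C x) = c *\<^sub>C gprod p m i x"
  by (induction m arbitrary: i) (auto simp: g_scale p_disc)

lemma gprod_diff: "i + m \<le> n \<Longrightarrow> gprod p m i (x - y) = gprod p m i x - gprod p m i y"
  by (induction m arbitrary: i) (auto simp: g_diff p_disc)

lemma gprod_bound: "i + m \<le> n \<Longrightarrow> q (gprod p m i x) \<le> M ^ Suc m * q x"
proof (induction m arbitrary: i)
  case 0
  then show ?case using g_bound p_disc by simp
next
  case (Suc m)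
  have "q (gprod p (Suc m) i x) \<le> M * q (gprod p m (Suc i) x)"
    using Suc.prems by (simp add: g_bound p_disc)
  also have "\<dots> \<le> M * (M ^ Suc m * q x)"
    using Suc by (intro mult_left_mono M_nonneg) auto
  finally show ?case by (simp add: mult_ac)
qed

text \<open>Both products share the factors at \<open>p (Suc i)\<close>, ...,
  \<open>p (i + m)\<close>. Pulling these out leaves the difference of the resolvents at the two end
  nodes, which are \<open>Suc m\<close> steps apart, and the resolvent identity applies.\<close>

lemma fdiff_gprod:
  assumes "i + Suc m \<le> n"
  shows "gprod p m (Suc i) x - gprod p m i x = (of_nat (Suc m) * d) *\<^sub>C T (gprod p (Suc m) i x)"
proof (cases m)
  \<comment> \<open>The shared product is empty here, and \<open>gprod\<close> does not represent
    the empty product.\<close>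
  case 0
  have "p (Suc i) - p i = d"
    by (simp add: p_arith algebra_simps)
  then show ?thesis
    using 0 assms resolvent_identity[of "p i" "p (Suc i)" x] by (simp add: p_disc)
next
  case (Suc k)
  let ?w = "p (Suc (Suc (i + k)))"
  have wz: "?w - p i = of_nat (Suc m) * d"
    using Suc by (simp add: p_arith algebra_simps)
  have "gprod p m (Suc i) x - gprod p m i x
      = gprod p k (Suc i) (g ?w x) - gprod p k (Suc i) (g (p i) x)"
    unfolding Suc using assms Suc by (subst gprod_last) (simp add: gprod_g p_disc)
  also have "\<dots> = gprod p k (Suc i) (g ?w x - g (p i) x)"
    using assms Suc by (simp add: gprod_diff)
  also have "\<dots> = (?w - p i) *\<^sub>C T (g (p i) (gprod p k (Suc i) (g ?w x)))"
    using assms Suc by (simp add: resolvent_identity gprod_scale gprod_T gprod_g p_disc)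
  also have "gprod p k (Suc i) (g ?w x) = gprod p m (Suc i) x"
    unfolding Suc gprod_last by simp
  finally show ?thesis
    by (simp add: wz)
qed

text \<open>Each further order contributes a factor \<open>(m + 1) d T\<close> by
  \<open>fdiff_gprod\<close>. The formula is exact, which makes the \<open>m\<close>-th difference
  of size \<open>d ^ m\<close>.\<close>

lemma funpow_fdiff_g:
  "i + m \<le> n \<Longrightarrow>
    (fdiff ^^ m) (\<lambda>j. g (p j) x) i = (fact m * d ^ m) *\<^sub>C (T ^^ m) (gprod p m i x)"
proof (induction m arbitrary: i)
  case 0
  then show ?case by simp
next
  case (Suc m)
  interpret Tm: Vector_Spaces.linear scaleC scaleC "T ^^ m"
    by (rule clinear_funpow) (rule T.linear_axioms)
  have "(fdiff ^^ Suc m) (\<lambda>j. g (p j) x) i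
      = (fact m * d ^ m) *\<^sub>C (T ^^ m) (gprod p m (Suc i) x - gprod p m i x)"
    using Suc.IH[of i] Suc.IH[of "Suc i"] Suc.prems
    unfolding funpow_Suc_fdiff by (simp add: Tm.diff cvs.scale_right_diff_distrib)
  also have "\<dots> = (fact m * d ^ m * (of_nat (Suc m) * d)) *\<^sub>C (T ^^ m) (T (gprod p (Suc m) i x))"
    using Suc.prems fdiff_gprod[of i m x] by (simp only: Tm.scale cvs.scale_scale add_Suc_right)
  also have "fact m * d ^ m * (of_nat (Suc m) * d) = fact (Suc m) * d ^ Suc m"
    by (simp add: algebra_simps)
  finally show ?case
    by (simp only: funpow_Suc_right comp_def)
qed

end

lemma funpow_T_bound: "q ((T ^^ n) x) \<le> L ^ n * q x"
proof (induction n)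
  case (Suc n)
  have "q ((T ^^ Suc n) x) \<le> L * q ((T ^^ n) x)"
    by (simp add: T_bound)
  also have "\<dots> \<le> L * (L ^ n * q x)"
    by (intro mult_left_mono Suc L_nonneg)
  finally show ?case by (simp add: mult_ac)
qed simp

lemma q_funpow_fdiff_g_le:
  assumes "\<And>j. j \<le> m \<Longrightarrow> cmod (z + of_nat j * d) \<le> 1"
  shows "q ((fdiff ^^ m) (\<lambda>j. g (z + of_nat j * d) x) 0)
    \<le> fact m * cmod d ^ m * L ^ m * M ^ Suc m * q x"
proof -
  let ?P = "gprod (\<lambda>j. z + of_nat j * d) m 0 x"
  have "q ((T ^^ m) ?P) \<le> L ^ m * (M ^ Suc m * q x)"
  proof (rule order_trans[OF funpow_T_bound], intro mult_left_mono)
    show "q ?P \<le> M ^ Suc m * q x"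
      using assms by (intro gprod_bound[of m]) auto
  qed (simp add: L_nonneg)
  then have "fact m * cmod d ^ m * q ((T ^^ m) ?P) \<le> fact m * cmod d ^ m * (L ^ m * (M ^ Suc m * q x))"
    by (intro mult_left_mono) auto
  then show ?thesis
    using funpow_fdiff_g[of m "\<lambda>j. z + of_nat j * d" z d 0 m x] assms
    by (simp add: scale norm_mult norm_power mult_ac)
qed

end

section \<open>Averages over roots of unity\<close>

lemma cis_root_power: "0 < N \<Longrightarrow> cis (2 * pi * real j / real N) ^ N = 1"
proof -
  assume "0 < N"
  then have "real N * (2 * pi * real j / real N) = 2 * pi * real j"
    by simp
  then show ?thesis
    by (simp only: Complex.DeMoivre) (simp add: cis_multiple_2pi)
qed

text \<open>Exchanging index and exponent turns the sum into a geometric one with ratio the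
  \<open>i\<close>-th root of unity, which differs from 1 when \<open>0 < i < N\<close>.\<close>

lemma sum_cis_power:
  assumes "i < N"
  shows "(\<Sum>j<N. cis (2 * pi * real j / real N) ^ i) = (if i = 0 then of_nat N else 0)"
proof (cases "i = 0")
  case False
  define r where "r = cis (2 * pi * real i / real N)"
  have "inj_on (\<lambda>k. cis (2 * pi * real k / real N)) {..<N}"
    using Complex.bij_betw_roots_unity[of N] assms by (auto simp: bij_betw_def)
  from inj_onD[OF this, of i 0] have "r \<noteq> 1"
    using assms False by (auto simp: r_def)
  moreover have "r ^ N = 1"
    using assms by (simp add: r_def cis_root_power)
  ultimately have "(\<Sum>j<N. r ^ j) = 0"
    by (simp add: geometric_sum)
  moreover have "cis (2 * pi * real j / real N) ^ i = r ^ j" for j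
    by (simp add: r_def Complex.DeMoivre mult_ac)
  ultimately show ?thesis
    using False by simp
qed simp

context resolvent_family
begin

interpretation Tn: Vector_Spaces.linear scaleC scaleC "T ^^ n" for n
  by (rule clinear_funpow) (rule T.linear_axioms)

text \<open>Inserting \<open>x = g z x - z T (g z x)\<close> into each new term of the finite
  geometric series makes it telescope.\<close>

lemma g_geometric:
  assumes "cmod z \<le> 1"
  shows "g z x - z ^ n *\<^sub>C (T ^^ n) (g z x) = (\<Sum>i<n. z ^ i *\<^sub>C (T ^^ i) x)"
proof (induction n)
  case (Suc n)
  have "z ^ n *\<^sub>C (T ^^ n) x = z ^ n *\<^sub>C (T ^^ n) (g z x - z *\<^sub>C T (g z x))"
    by (simp add: g_right assms)
  also have "\<dots> = z ^ n *\<^sub>C (T ^^ n) (g z x) - z ^ Suc n *\<^sub>C (T ^^ Suc n) (g z x)"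
    unfolding funpow_Suc_right
    by (simp add: Tn.diff Tn.scale cvs.scale_right_diff_distrib mult.commute)
  finally have "g z x - z ^ Suc n *\<^sub>C (T ^^ Suc n) (g z x)
      = (g z x - z ^ n *\<^sub>C (T ^^ n) (g z x)) + z ^ n *\<^sub>C (T ^^ n) x"
    by simp
  then show ?case
    by (simp only: Suc sum.lessThan_Suc)
qed simp

text \<open>
  On the circle of radius \<open>s\<close> the average of \<open>(1 - zT)\<^sup>-\<^sup>1\<close> over the rotated \<open>N\<close>-th roots of
  unity is \<open>(1 - s\<^sup>N T\<^sup>N)\<^sup>-\<^sup>1\<close>.
\<close>

definition avg :: "nat \<Rightarrow> real \<Rightarrow> 'a \<Rightarrow> 'a"
  where "avg N s x = (1 / of_nat N) *\<^sub>C (\<Sum>j<N. g (cis (2 * pi * real j / real N) * of_real s) x)"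

lemma avg_right:
  assumes N: "0 < N" and s: "\<bar>s\<bar> \<le> 1"
  shows "avg N s x - of_real (s ^ N) *\<^sub>C (T ^^ N) (avg N s x) = x"
proof -
  define w where "w j = cis (2 * pi * real j / real N)" for j
  have w: "cmod (w j * of_real s) \<le> 1" for j
    using s by (simp add: w_def norm_mult)
  \<comment> \<open>All the points share the same \<open>N\<close>-th power, so one operator
    \<open>T ^^ N\<close> can be taken out of the average.\<close>
  have wN: "(w j * of_real s) ^ N = of_real (s ^ N)" for j
    using cis_root_power[OF N] by (simp add: w_def power_mult_distrib)
  have "avg N s x - of_real (s ^ N) *\<^sub>C (T ^^ N) (avg N s x)
      = (1 / of_nat N) *\<^sub>C (\<Sum>j<N. g (w j * of_real s) x
          - (w j * of_real s) ^ N *\<^sub>C (T ^^ N) (g (w j * of_real s) x))"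
    unfolding avg_def w_def[symmetric] wN
    by (simp add: Tn.scale Tn.sum cvs.scale_right_diff_distrib sum_subtractf cvs.scale_sum_right
        mult.commute)
  also have "(\<Sum>j<N. g (w j * of_real s) x
          - (w j * of_real s) ^ N *\<^sub>C (T ^^ N) (g (w j * of_real s) x))
      = (\<Sum>j<N. \<Sum>i<N. (w j * of_real s) ^ i *\<^sub>C (T ^^ i) x)"
    by (simp only: g_geometric[OF w])
  also have "\<dots> = (\<Sum>i<N. ((\<Sum>j<N. w j ^ i) * of_real s ^ i) *\<^sub>C (T ^^ i) x)"
    by (subst sum.swap)
      (simp add: power_mult_distrib cvs.scale_sum_left[symmetric] sum_distrib_right[symmetric])
  \<comment> \<open>The roots of unity cancel every power of \<open>T\<close> except the one for
    \<open>i = 0\<close>, whose weight \<open>N\<close> is offset by the factor in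
    \<open>avg\<close>.\<close>
  also have "\<dots> = (\<Sum>i<N. if i = 0 then of_nat N *\<^sub>C x else 0)"
    by (rule sum.cong) (auto simp: w_def sum_cis_power)
  also have "\<dots> = of_nat N *\<^sub>C x"
    using N by simp
  finally show ?thesis
    using N by simp
qed

lemma avg_left:
  assumes N: "0 < N" and s: "\<bar>s\<bar> \<le> 1"
  shows "avg N s (x - of_real (s ^ N) *\<^sub>C (T ^^ N) x) = x"
proof -
  have w: "cmod (cis t * of_real s) \<le> 1" for t
    using s by (simp add: norm_mult)
  have "avg N s (x - of_real (s ^ N) *\<^sub>C (T ^^ N) x)
      = avg N s x - of_real (s ^ N) *\<^sub>C (T ^^ N) (avg N s x)"
    unfolding avg_def Tn.scale Tn.sum cvs.scale_left_commute[of "of_real (s ^ N)"]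
    by (simp only: g_diff g_scale g_funpow w cvs.scale_right_diff_distrib sum_subtractf
        cvs.scale_sum_right)
  then show ?thesis
    using avg_right[OF assms] by simp
qed

text \<open>For \<open>w = avg N s x\<close> the difference \<open>w - x\<close> equals
  \<open>s ^ N\<close> times \<open>(T ^^ N) w\<close>, hence has size at most \<epsilon> times that
  of \<open>w\<close>. Either \<open>x\<close> controls \<open>w\<close>, or \<open>w - x\<close>
  dominates and \<open>a * \<epsilon> < 1\<close> forces \<open>q w = 0\<close>.\<close>

lemma avg_near_id:
  assumes N: "0 < N" and s: "0 \<le> s" "s \<le> 1"
    and small: "\<And>x. s ^ N * q ((T ^^ N) x) \<le> \<epsilon> * q x"
    and \<epsilon>: "0 \<le> \<epsilon>" "a * \<epsilon> < 1"
  shows "q (avg N s x - x) \<le> a * \<epsilon> * q x"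
proof -
  define w where "w = avg N s x"
  have w: "w - x = of_real (s ^ N) *\<^sub>C (T ^^ N) w"
    using avg_right[OF N, of s x] s by (simp add: w_def algebra_simps)
  then have qw: "q (w - x) \<le> \<epsilon> * q w"
    using small[of w] s by (simp add: scale norm_power)
  have "q w \<le> a * q x"
  proof (cases "q (w - x) \<le> q x")
    case True
    then show ?thesis using add_le[of x "q x" "w - x"] by simp
  next
    case False
    then have "q w \<le> a * (\<epsilon> * q w)"
      using add_le[of x "\<epsilon> * q w" "w - x"] qw by simp
    then have "(1 - a * \<epsilon>) * q w \<le> 0"
      by (simp add: algebra_simps)
    then have "q w = 0"
      using \<epsilon> nonneg[of w] by (simp add: mult_le_0_iff)
    then show ?thesis using a_ge_1 by simp
  qed
  then have "\<epsilon> * q w \<le> \<epsilon> * (a * q x)"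
    using \<epsilon>(1) by (rule mult_left_mono)
  then show ?thesis
    using qw by (simp add: w_def mult_ac)
qed

text \<open>Let \<open>y\<close> be \<open>s ^ N\<close> times \<open>(T ^^ N) x\<close>. The
  average maps \<open>x - y\<close> to \<open>x\<close>, so its deviation from the identity at
  \<open>x - y\<close> is \<open>y\<close> itself; \<open>a * \<delta> < 1\<close> excludes that
  \<open>y\<close> dominates \<open>x\<close>.\<close>

lemma small_of_avg_near_id:
  assumes N: "0 < N" and s: "0 \<le> s" "s \<le> 1"
    and near: "\<And>x. q (avg N s x - x) \<le> \<delta> * q x"
    and \<delta>: "0 \<le> \<delta>" "a * \<delta> < 1"
  shows "s ^ N * q ((T ^^ N) x) \<le> a * \<delta> * q x"
proof -
  define y where "y = of_real (s ^ N) *\<^sub>C (T ^^ N) x"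
  have qy: "q y = s ^ N * q ((T ^^ N) x)"
    using s by (simp add: y_def scale norm_power)
  have "q y \<le> \<delta> * q (x - y)"
    using near[of "x - y"] avg_left[OF N, of s x] s by (simp add: y_def)
  also have "\<dots> \<le> \<delta> * (a * max (q x) (q y))"
    using \<delta>(1) by (intro mult_left_mono diff_le) auto
  finally have *: "q y \<le> a * \<delta> * max (q x) (q y)"
    by (simp add: mult_ac)
  show ?thesis
  proof (cases "q y \<le> q x")
    case True
    then show ?thesis using * by (simp add: qy max_def)
  next
    case False
    then have "(1 - a * \<delta>) * q y \<le> 0"
      using * by (simp add: max_def algebra_simps)
    then have "q y = 0"
      using \<delta> nonneg[of y] by (simp add: mult_le_0_iff)
    then show ?thesis using False by simp
  qed
qed

text \<open>
  The higher difference gains \<open>h\<^sup>m\<close>, while averaging over \<open>4\<^sup>k\<close> points costs \<open>a\<^sup>2\<^sup>k\<close> because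
  \<open>q\<close> is only quasi-subadditive.
\<close>

lemma funpow_fdiff_avg_le:
  assumes s: "0 \<le> s" and h: "0 \<le> h" and sh: "s + real m * h \<le> 1"
  shows "q ((fdiff ^^ m) (\<lambda>i. avg (4 ^ k) (s + real i * h) x) 0)
    \<le> a ^ (2 * k) * (fact m * h ^ m * L ^ m * M ^ Suc m * q x)"
proof -
  \<comment> \<open>\<open>4 ^ k\<close> is written as a power of two so that the binary bracketing
    of \<open>sum_pow2_le\<close> has depth \<open>2 * k\<close>.\<close>
  define N where "N = (2::nat) ^ (2 * k)"
  define w where "w j = cis (2 * pi * real j / real N)" for j
  define b where "b = fact m * h ^ m * L ^ m * M ^ Suc m * q x"
  have b: "0 \<le> b"
    using h L_nonneg M_nonneg by (simp add: b_def)
  have N: "(4::nat) ^ k = N"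
    by (simp add: N_def power_mult)
  \<comment> \<open>On the ray through \<open>w j\<close> equally spaced radii give an arithmetic
    progression with step \<open>w j * h\<close>, so differences in the radius become differences of
    \<open>g\<close>.\<close>
  have eq: "avg N (s + real i * h) x
      = (1 / of_nat N) *\<^sub>C (\<Sum>j<N. g (w j * of_real s + of_nat i * (w j * of_real h)) x)" for i
    by (simp add: avg_def w_def algebra_simps)
  have "q (\<Sum>j<N. (fdiff ^^ m) (\<lambda>i. g (w j * of_real s + of_nat i * (w j * of_real h)) x) 0)
      \<le> a ^ (2 * k) * b"
    unfolding N_def
  proof (rule sum_pow2_le)
    fix j
    have "cmod (w j * of_real s + of_nat i * (w j * of_real h)) \<le> 1" if "i \<le> m" for i
    proof -
      have "w j * of_real s + of_nat i * (w j * of_real h) = w j * of_real (s + real i * h)"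
        by (simp add: algebra_simps)
      then have "cmod (w j * of_real s + of_nat i * (w j * of_real h)) = s + real i * h"
        using s h by (simp only: norm_mult norm_of_real) (simp add: w_def)
      also have "\<dots> \<le> s + real m * h"
        using that h by (simp add: mult_right_mono)
      finally show ?thesis using sh by simp
    qed
    then have "q ((fdiff ^^ m) (\<lambda>i. g (w j * of_real s + of_nat i * (w j * of_real h)) x) 0)
        \<le> fact m * cmod (w j * of_real h) ^ m * L ^ m * M ^ Suc m * q x"
      by (rule q_funpow_fdiff_g_le)
    then show "q ((fdiff ^^ m) (\<lambda>i. g (w j * of_real s + of_nat i * (w j * of_real h)) x) 0) \<le> b"
      using h by (simp add: b_def w_def norm_mult)
  qed
  moreover have "1 \<le> real N"
    by (simp add: N_def)
  ultimately have "1 / real N * q (\<Sum>j<N. (fdiff ^^ m) (\<lambda>i. g (w j * of_real s + of_nat i * (w j * of_real h)) x) 0)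
      \<le> 1 * (a ^ (2 * k) * b)"
    by (intro mult_mono) auto
  then show ?thesis
    unfolding N eq funpow_fdiff_scaleC funpow_fdiff_sum by (simp add: scale b_def norm_divide)
qed

text \<open>Smallness at radius \<open>s + m h\<close> makes the averages at the
  \<open>Suc m\<close> radii up to there close to the identity, at the cost of one factor
  \<open>a\<close>. Extrapolation by the difference bound reaches the next radius, costing
  \<open>a ^ (2 * Suc m)\<close>, and the return to the power costs another
  \<open>a\<close>.\<close>

lemma radius_step:
  assumes s: "0 \<le> s" and h: "0 \<le> h" and sh: "s + real (Suc m) * h \<le> 1"
    and small: "\<And>x. (s + real m * h) ^ (4 ^ k) * q ((T ^^ (4 ^ k)) x) \<le> \<epsilon> * q x"
    and \<epsilon>: "0 \<le> \<epsilon>" "a ^ (2 * Suc m + 2) * \<epsilon> < 1"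
    and diff: "a ^ (2 * k) * (fact (Suc m) * h ^ Suc m * L ^ Suc m * M ^ Suc (Suc m)) \<le> a * \<epsilon>"
  shows "(s + real (Suc m) * h) ^ (4 ^ k) * q ((T ^^ (4 ^ k)) x) \<le> a ^ (2 * Suc m + 2) * \<epsilon> * q x"
proof -
  have a\<epsilon>: "a * \<epsilon> < 1"
    using \<epsilon> power_increasing[of 1 "2 * Suc m + 2" a] a_ge_1 mult_right_mono[OF _ \<epsilon>(1)]
    by (metis (no_types, opaque_lifting) add_leD2 le_add2 le_trans one_le_numeral order.strict_trans1 power_one_right)
  have near: "q (avg (4 ^ k) (s + real (Suc m) * h) y - y) \<le> a ^ (2 * Suc m) * (a * \<epsilon> * q y)" for y
  proof (rule le_of_fdiff_le)
    fix i assume "i < Suc m"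
    then have i: "s + real i * h \<le> s + real m * h"
      using h by (simp add: mult_right_mono)
    show "q (avg (4 ^ k) (s + real i * h) y - y) \<le> a * \<epsilon> * q y"
    proof (rule avg_near_id[OF _ _ _ _ \<epsilon>(1) a\<epsilon>])
      show "(s + real i * h) ^ 4 ^ k * q ((T ^^ 4 ^ k) x) \<le> \<epsilon> * q x" for x
        by (rule order_trans[OF mult_right_mono[OF power_mono[OF i]] small]) (use s h in auto)
      show "s + real i * h \<le> 1"
        using i sh h by (simp add: algebra_simps)
    qed (use s h in auto)
  next
    have "q ((fdiff ^^ Suc m) (\<lambda>i. avg (4 ^ k) (s + real i * h) y) 0)
        \<le> a ^ (2 * k) * (fact (Suc m) * h ^ Suc m * L ^ Suc m * M ^ Suc (Suc m) * q y)"
      by (rule funpow_fdiff_avg_le[OF s h sh])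
    also have "\<dots> \<le> a * \<epsilon> * q y"
      using mult_right_mono[OF diff nonneg[of y]] by (simp add: mult_ac)
    finally show "q ((fdiff ^^ Suc m) (\<lambda>i. avg (4 ^ k) (s + real i * h) y - y) 0) \<le> a * \<epsilon> * q y"
      by (simp only: funpow_Suc_fdiff_shift)
  qed
  have "(s + real (Suc m) * h) ^ (4 ^ k) * q ((T ^^ (4 ^ k)) x) \<le> a * (a ^ (2 * Suc m) * (a * \<epsilon>)) * q x"
  proof (rule small_of_avg_near_id)
    show "q (avg (4 ^ k) (s + real (Suc m) * h) x - x) \<le> a ^ (2 * Suc m) * (a * \<epsilon>) * q x" for x
      using near[of x] by (simp only: mult_ac)
    show "a * (a ^ (2 * Suc m) * (a * \<epsilon>)) < 1"
      using \<epsilon>(2) by (simp add: mult_ac)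
  qed (use s h sh \<epsilon> a_ge_1 in auto)
  then show ?thesis
    by (simp add: mult_ac)
qed

text \<open>The radius marches from near 0 to near 1 with \<open>N = 4 ^ k\<close> and
  \<open>h = 2 ^ (-k)\<close>. Each round goes out by \<open>h\<close> with
  \<open>radius_step\<close>, which worsens the constant from \<epsilon> to \<open>1 / 2\<close>,
  and then retreats by \<open>h / 2\<close>. The retreat shrinks the \<open>N\<close>-th power by at
  least \<open>exp (- (2 ^ k) / 2)\<close>, which restores \<epsilon>, so each round gains
  \<open>h / 2\<close>.\<close>

proposition exists_small_power:
  assumes \<eta>: "0 < \<eta>" "\<eta> \<le> 1"
  shows "\<exists>N>0. \<forall>x. (1 - \<eta>) ^ N * q ((T ^^ N) x) \<le> q x / 2"
proof -
  \<comment> \<open>This order makes the gain \<open>h ^ Suc m\<close> beat the averaging loss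
    \<open>a ^ (2 * k)\<close>: their product is \<open>r ^ k\<close> with
    \<open>r < 1\<close>.\<close>
  obtain m where m: "a ^ 2 < 2 ^ m"
    using real_arch_pow[of 2 "a ^ 2"] by auto
  define A where "A = a ^ (2 * Suc m + 2)"
  \<comment> \<open>\<open>A\<close> is the loss in \<open>radius_step\<close>, so the constant
    after one application is \<open>1 / 2\<close>.\<close>
  define \<epsilon> where "\<epsilon> = 1 / (2 * A)"
  define r where "r = a ^ 2 / 2 ^ Suc m"
  define D where "D = fact (Suc m) * L ^ Suc m * M ^ Suc (Suc m)"
  have A: "1 \<le> A"
    unfolding A_def by (rule one_le_power[OF a_ge_1])
  then have \<epsilon>: "0 < \<epsilon>" "\<epsilon> \<le> 1 / 2" and A\<epsilon>: "A * \<epsilon> = 1 / 2"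
    by (auto simp: \<epsilon>_def field_simps)
  have r: "0 \<le> r" "r < 1"
    using order.strict_trans2[OF m, of "2 ^ Suc m"] by (auto simp: r_def)
  have lim: "(\<lambda>k. c * (1 / 2) ^ k) \<longlonglongrightarrow> 0" for c :: real
    by (intro tendsto_mult_right_zero LIMSEQ_power_zero) simp
  have "(\<lambda>k. D * r ^ k) \<longlonglongrightarrow> 0"
    using r by (intro tendsto_mult_right_zero LIMSEQ_power_zero) simp
  then have "\<forall>\<^sub>F k in sequentially. D * r ^ k < a * \<epsilon>"
    by (rule order_tendstoD) (use a_ge_1 \<epsilon> in auto)
  moreover have "\<forall>\<^sub>F k in sequentially. 2 * (1 / 2) ^ k < \<epsilon>"
    by (rule order_tendstoD[OF lim]) (use \<epsilon> in auto)
  moreover have "\<forall>\<^sub>F k in sequentially. (real m * L) * (1 / 2) ^ k < 1 / 2"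
    by (rule order_tendstoD[OF lim]) auto
  moreover have "\<forall>\<^sub>F k in sequentially. 1 * (1 / 2) ^ k < \<eta>"
    by (rule order_tendstoD[OF lim]) (use \<eta> in auto)
  moreover have "\<forall>\<^sub>F k in sequentially. real (Suc m) * (1 / 2) ^ k < 1"
    by (rule order_tendstoD[OF lim]) auto
  \<comment> \<open>In order: the difference estimate, the restoration of \<epsilon>, the start at
    radius \<open>m h\<close>, the arrival beyond \<open>1 - \<eta>\<close>, and room for the nodes
    inside the unit interval.\<close>
  ultimately have "\<forall>\<^sub>F k in sequentially. D * r ^ k < a * \<epsilon> \<and> 2 * (1 / 2) ^ k < \<epsilon> \<and>
      (real m * L) * (1 / 2) ^ k < 1 / 2 \<and> 1 * (1 / 2) ^ k < \<eta> \<and> real (Suc m) * (1 / 2) ^ k < 1"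
    by eventually_elim blast
  then obtain k where k: "D * r ^ k < a * \<epsilon>" "2 * (1 / 2) ^ k < \<epsilon>"
      "(real m * L) * (1 / 2) ^ k < 1 / 2" "(1 / 2) ^ k < \<eta>" "real (Suc m) * (1 / 2) ^ k < 1"
    by (auto simp: eventually_sequentially)
  define N where "N = (4::nat) ^ k"
  define h where "h = (1 / 2 :: real) ^ k"
  have h: "0 < h" "h \<le> 1"
    by (auto simp: h_def power_le_one)
  have "real N * h = 2 ^ k"
    by (simp add: N_def h_def flip: power_mult_distrib)
  have "h * 2 ^ k = 1"
    by (simp add: h_def flip: power_mult_distrib)
  have shrink: "(1 - h / 2) ^ N \<le> \<epsilon>"
  proof -
    have "(1 - h / 2) ^ N \<le> exp (- (h / 2)) ^ N"
      using h exp_ge_add_one_self[of "- (h / 2)"] by (intro power_mono) auto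
    also have "\<dots> = 1 / exp (real N * h / 2)"
      using exp_minus[of "real N * h / 2"] by (simp add: inverse_eq_divide flip: exp_of_nat_mult)
    also have "\<dots> \<le> 1 / (2 ^ k / 2)"
      using order_trans[OF _ exp_ge_add_one_self, of "2 ^ k / 2" "2 ^ k / 2"] \<open>real N * h = 2 ^ k\<close>
      by (intro divide_left_mono) simp_all
    also have "\<dots> = 2 * (1 / 2) ^ k"
      by (simp add: power_one_over)
    finally show ?thesis using k(2) by simp
  qed
  have diff: "a ^ (2 * k) * (fact (Suc m) * h ^ Suc m * L ^ Suc m * M ^ Suc (Suc m)) \<le> a * \<epsilon>"
  proof -
    have "h ^ Suc m = 1 / (2 ^ Suc m) ^ k"
      unfolding h_def by (metis power_mult mult.commute power_one_over)
    then have "a ^ (2 * k) * h ^ Suc m = r ^ k"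
      by (simp add: r_def power_divide power_mult)
    moreover have "a ^ (2 * k) * (fact (Suc m) * h ^ Suc m * L ^ Suc m * M ^ Suc (Suc m))
        = D * (a ^ (2 * k) * h ^ Suc m)"
      unfolding D_def by (simp only: mult_ac)
    ultimately show ?thesis using k(1) by simp
  qed
  \<comment> \<open>The outermost of the nodes \<open>n h / 2 + i h\<close> with
    \<open>i \<le> m\<close>; the base point of the nodes moves by half steps.\<close>
  define t where "t n = real n * (h / 2) + real m * h" for n
  have march: "t n \<le> 1 - h / 2 \<Longrightarrow> t n ^ N * q ((T ^^ N) x) \<le> \<epsilon> * q x" for n x
  proof (induction n arbitrary: x)
    case 0
    \<comment> \<open>At the starting radius the crude bound \<open>L ^ N\<close> for the power
      suffices.\<close>
    have "real m * h * L \<le> 1 / 2"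
      using k(3) by (simp add: h_def mult_ac)
    then have "(real m * h * L) ^ N \<le> (1 / 2) ^ N"
      using h L_nonneg by (intro power_mono) auto
    also have "\<dots> \<le> (1 / 2) ^ k"
      unfolding N_def by (intro power_decreasing) (auto intro: less_imp_le less_exp
          order.strict_trans2[OF less_exp] power_mono)
    also have "\<dots> \<le> \<epsilon>"
      using k(2) zero_le_power[of "1 / 2 :: real" k] by linarith
    finally have "(real m * h * L) ^ N * q x \<le> \<epsilon> * q x"
      by (rule mult_right_mono) simp
    moreover have "(real m * h) ^ N * q ((T ^^ N) x) \<le> (real m * h) ^ N * (L ^ N * q x)"
      using h by (intro mult_left_mono funpow_T_bound) auto
    ultimately show ?case
      by (simp add: t_def power_mult_distrib mult_ac)
  next
    case (Suc n)
    have t: "t (Suc n) = t n + h / 2" "t n + h \<le> 1" "0 \<le> t n"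
      using Suc.prems h by (auto simp: t_def algebra_simps add_divide_distrib)
    have "(real n * (h / 2) + real (Suc m) * h) ^ 4 ^ k * q ((T ^^ 4 ^ k) x)
        \<le> a ^ (2 * Suc m + 2) * \<epsilon> * q x"
    proof (rule radius_step)
      show "real n * (h / 2) + real (Suc m) * h \<le> 1"
        using t(2) by (simp add: t_def algebra_simps)
      show "(real n * (h / 2) + real m * h) ^ 4 ^ k * q ((T ^^ 4 ^ k) x) \<le> \<epsilon> * q x" for x
        using Suc.IH[of x] t h by (simp add: t_def N_def)
      show "a ^ (2 * Suc m + 2) * \<epsilon> < 1"
        using A\<epsilon> by (simp add: A_def)
    qed (use h \<epsilon> diff in auto)
    then have "(t n + h) ^ N * q ((T ^^ N) x) \<le> 1 / 2 * q x"
      unfolding A_def[symmetric] A\<epsilon> by (simp add: t_def N_def algebra_simps)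
    also have "\<dots> \<le> 1 * q x"
      by (rule mult_right_mono) simp_all
    finally have big: "(t n + h) ^ N * q ((T ^^ N) x) \<le> 1 * q x" .
    \<comment> \<open>Because \<open>t n + h \<le> 1\<close>, the retreat by \<open>h / 2\<close> is
      at least a multiplication by \<open>1 - h / 2\<close>.\<close>
    have "t n + h / 2 \<le> (1 - h / 2) * (t n + h)"
      using mult_left_mono[OF t(2), of "h / 2"] h unfolding left_diff_distrib by simp
    then have "(t n + h / 2) ^ N \<le> ((1 - h / 2) * (t n + h)) ^ N"
      using t(3) h by (intro power_mono) auto
    then have "(t n + h / 2) ^ N * q ((T ^^ N) x) \<le> (1 - h / 2) ^ N * ((t n + h) ^ N * q ((T ^^ N) x))"
      using mult_right_mono[OF _ nonneg] by (simp only: power_mult_distrib mult.assoc[symmetric])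
    also have "\<dots> \<le> \<epsilon> * (1 * q x)"
      using t(3) h \<epsilon> by (intro mult_mono[OF shrink big]) auto
    finally show ?case using t(1) by simp
  qed
  have "real (Suc m) \<le> real (2 ^ k)"
    using k(5) \<open>h * 2 ^ k = 1\<close> h by (simp add: h_def field_simps power_one_over)
  then have mk: "Suc m \<le> 2 ^ k"
    by (simp only: of_nat_le_iff)
  \<comment> \<open>The number of half steps that ends at \<open>1 - h / 2\<close>;
    \<open>mk\<close> keeps the subtraction of naturals from truncating.\<close>
  define n where "n = 2 * 2 ^ k - (1 + 2 * m)"
  have rn: "real n = 2 * 2 ^ k - (1 + 2 * real m)"
    unfolding n_def using mk by (subst of_nat_diff) auto
  have "t n = 2 ^ k * h - h / 2"
    unfolding t_def rn by (simp add: field_simps)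
  then have tn: "t n = 1 - h / 2"
    using \<open>h * 2 ^ k = 1\<close> by (simp add: mult.commute)
  have "(1 - \<eta>) ^ N * q ((T ^^ N) x) \<le> q x / 2" for x
  proof -
    have "(1 - \<eta>) ^ N * q ((T ^^ N) x) \<le> t n ^ N * q ((T ^^ N) x)"
      unfolding tn using \<eta> k(4) h by (intro mult_right_mono power_mono) (auto simp: h_def)
    also have "\<dots> \<le> \<epsilon> * q x"
      using march[of n x] tn by simp
    also have "\<dots> \<le> 1 / 2 * q x"
      using \<epsilon> by (intro mult_right_mono) auto
    finally show ?thesis by simp
  qed
  moreover have "0 < N"
    by (simp add: N_def)
  ultimately show ?thesis by blast
qed

end

section \<open>Topological preliminaries\<close>

lemma scaleC_scaleR_commute:
  fixes x :: "'a::complex_vector"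
  shows "c *\<^sub>C (r *\<^sub>R x) = r *\<^sub>R (c *\<^sub>C x)"
  by (simp add: scaleR_scaleC mult.commute)

lemma tendsto_scaleC:
  fixes x :: "'a::complex_tvs"
  assumes "(f \<longlongrightarrow> c) F" "(g \<longlongrightarrow> x) F"
  shows "((\<lambda>t. f t *\<^sub>C g t) \<longlongrightarrow> c *\<^sub>C x) F"
  using filterlim_compose[OF tendsto_scaleC_Pair[of c x] filterlim_Pair[OF assms]] by simp

lemma tendsto_scaleR_tvs:
  fixes x :: "'a::complex_tvs"
  assumes "(f \<longlongrightarrow> r) F" "(g \<longlongrightarrow> x) F"
  shows "((\<lambda>t. f t *\<^sub>R g t) \<longlongrightarrow> r *\<^sub>R x) F"
  unfolding scaleR_scaleC by (intro tendsto_scaleC tendsto_of_real assms)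

lemma zero_nbhd_iff: "zero_nbhd U \<longleftrightarrow> (\<forall>\<^sub>F x in nhds 0. x \<in> U)"
  unfolding zero_nbhd_def eventually_nhds interior_def by blast

lemma zero_nbhd_Int: "zero_nbhd U \<Longrightarrow> zero_nbhd V \<Longrightarrow> zero_nbhd (U \<inter> V)"
  by (simp add: zero_nbhd_def)

lemma mem_scaleC_image:
  fixes U :: "'a::complex_vector set"
  shows "c \<noteq> 0 \<Longrightarrow> x \<in> (\<lambda>y. c *\<^sub>C y) ` U \<longleftrightarrow> inverse c *\<^sub>C x \<in> U"
  by (auto simp: image_iff intro: bexI[of _ "inverse c *\<^sub>C x"])

lemma mem_scaleR_image:
  fixes U :: "'a::real_vector set"
  shows "r \<noteq> 0 \<Longrightarrow> x \<in> (\<lambda>y. r *\<^sub>R y) ` U \<longleftrightarrow> inverse r *\<^sub>R x \<in> U"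
  by (auto simp: image_iff intro: bexI[of _ "inverse r *\<^sub>R x"])

lemma zero_nbhd_scaleR:
  assumes "zero_nbhd U" "r \<noteq> 0"
  shows "zero_nbhd ((\<lambda>y. r *\<^sub>R y) ` U)"
proof -
  have "((\<lambda>x. inverse r *\<^sub>R x) \<longlongrightarrow> inverse r *\<^sub>R 0) (nhds (0::'a))"
    by (intro tendsto_scaleR_tvs tendsto_const filterlim_ident)
  then have "\<forall>\<^sub>F x in nhds 0. inverse r *\<^sub>R x \<in> U"
    using assms(1) by (auto simp: zero_nbhd_iff filterlim_iff)
  then show ?thesis
    by (simp add: zero_nbhd_iff mem_scaleR_image assms(2))
qed

lemma zero_nbhd_absorbing:
  assumes "zero_nbhd U"
  obtains t :: real where "0 < t" "x \<in> (\<lambda>y. t *\<^sub>R y) ` U"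
proof -
  have "((\<lambda>r. r *\<^sub>R x) \<longlongrightarrow> 0 *\<^sub>R x) (at_right 0)"
    by (intro tendsto_scaleR_tvs tendsto_const tendsto_ident_at)
  then have "\<forall>\<^sub>F r in at_right 0. r *\<^sub>R x \<in> U"
    using assms by (auto simp: zero_nbhd_iff filterlim_iff)
  with eventually_at_right_less[of 0] have "\<forall>\<^sub>F r in at_right 0. 0 < r \<and> r *\<^sub>R x \<in> U"
    by eventually_elim simp
  then obtain r :: real where "0 < r" "r *\<^sub>R x \<in> U"
    by (auto dest: eventually_happens)
  then show thesis
    by (intro that[of "inverse r"]) (auto simp: mem_scaleR_image)
qed

lemma cbalancedD: "cbalanced U \<Longrightarrow> cmod c \<le> 1 \<Longrightarrow> x \<in> U \<Longrightarrow> c *\<^sub>C x \<in> U"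
  unfolding cbalanced_def by blast

lemma cbalancedD_le:
  assumes "cbalanced U" "b *\<^sub>C x \<in> U" "cmod c \<le> cmod b"
  shows "c *\<^sub>C x \<in> U"
proof (cases "b = 0")
  case False
  then have "(c / b) *\<^sub>C b *\<^sub>C x \<in> U"
    using assms by (intro cbalancedD[of U "c / b" "b *\<^sub>C x"]) (auto simp: norm_divide divide_le_eq)
  with False show ?thesis by simp
qed (use assms in auto)

text \<open>Joint continuity of scaling at the origin gives a radius \<open>d\<close> and a
  neighborhood whose multiples by scalars below \<open>d\<close> stay in \<open>V\<close>. Its
  dilate by \<open>d / 2\<close> lies in the balanced core.\<close>

lemma zero_nbhd_balanced_core:
  fixes V :: "'a::complex_tvs set"
  assumes "zero_nbhd V"
  obtains U where "zero_nbhd U" "cbalanced U" "U \<subseteq> V"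
proof -
  define U where "U = {x. \<forall>c. cmod c \<le> 1 \<longrightarrow> c *\<^sub>C x \<in> V}"
  have "\<forall>\<^sub>F p in nhds (0::complex) \<times>\<^sub>F nhds (0::'a). fst p *\<^sub>C snd p \<in> V"
    using assms tendsto_scaleC_Pair[of 0 "0::'a"] by (auto simp: zero_nbhd_iff filterlim_iff)
  then obtain P Q where P: "\<forall>\<^sub>F c in nhds (0::complex). P c" and Q: "\<forall>\<^sub>F x in nhds (0::'a). Q x"
    and PQ: "\<And>c x. P c \<Longrightarrow> Q x \<Longrightarrow> c *\<^sub>C x \<in> V"
    by (auto simp: eventually_prod_filter)
  obtain d where d: "0 < d" "\<And>c. cmod c < d \<Longrightarrow> P c"
    using P by (auto simp: eventually_nhds_metric)
  have "zero_nbhd ((\<lambda>y. (d / 2) *\<^sub>R y) ` Collect Q)"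
    using Q d(1) by (intro zero_nbhd_scaleR) (auto simp: zero_nbhd_iff)
  moreover have "(\<lambda>y. (d / 2) *\<^sub>R y) ` Collect Q \<subseteq> U"
  proof (clarsimp simp: U_def scaleR_scaleC simp del: of_real_divide)
    fix x c assume "Q x" "cmod c \<le> 1"
    then show "(c * complex_of_real (d / 2)) *\<^sub>C x \<in> V"
      using d(1) by (intro PQ d(2)) (auto simp: norm_mult simp del: of_real_divide
          intro: order.strict_trans1[of _ "1 * (d / 2)"])
  qed
  ultimately have "zero_nbhd U"
    unfolding zero_nbhd_iff by (auto intro: eventually_mono)
  moreover have "cbalanced U"
    unfolding cbalanced_def U_def by (auto simp: norm_mult mult_le_one)
  moreover have "U \<subseteq> V"
    unfolding U_def by (metis (no_types, lifting) mem_Collect_eq norm_one order_refl scaleC_one subsetI)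
  ultimately show thesis by (rule that)
qed

lemma tvs_bounded_subset: "tvs_bounded A \<Longrightarrow> B \<subseteq> A \<Longrightarrow> tvs_bounded B"
  unfolding tvs_bounded_def by (meson order_trans)

lemma tvs_boundedE:
  assumes "tvs_bounded A" "zero_nbhd V"
  obtains \<alpha> :: real where "0 < \<alpha>" "\<And>x. x \<in> A \<Longrightarrow> inverse \<alpha> *\<^sub>R x \<in> V"
  using assms unfolding tvs_bounded_def by (metis less_irrefl mem_scaleR_image subsetD)

text \<open>The dilates of a balanced neighborhood by positive integers cover the space and
  increase, so the largest dilate of a finite subcover contains \<open>C\<close>.\<close>

lemma compact_imp_tvs_bounded:
  fixes C :: "'a::complex_tvs set"
  assumes "compact C"
  shows "tvs_bounded C"
  unfolding tvs_bounded_def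
proof (intro allI impI)
  fix V :: "'a set" assume "zero_nbhd V"
  then obtain U where U: "zero_nbhd U" "cbalanced U" "U \<subseteq> V"
    by (rule zero_nbhd_balanced_core)
  define W where "W n = (\<lambda>x. inverse (real (Suc n)) *\<^sub>R x) -` interior U" for n
  have "continuous_on UNIV (\<lambda>x::'a. r *\<^sub>R x)" for r
    unfolding continuous_on_def by (intro ballI tendsto_scaleR_tvs tendsto_const tendsto_ident_at)
  then have "open (W n)" for n
    unfolding W_def by (intro open_vimage open_interior)
  moreover have "C \<subseteq> (\<Union>n\<in>UNIV. W n)"
  proof
    fix x :: 'a
    have "(\<lambda>n. inverse (real (Suc n)) *\<^sub>R x) \<longlonglongrightarrow> 0 *\<^sub>R x"
      by (intro tendsto_scaleR_tvs tendsto_const LIMSEQ_inverse_real_of_nat)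
    then have "\<forall>\<^sub>F n in sequentially. x \<in> W n"
      using U(1) unfolding W_def zero_nbhd_def
      by (auto dest!: topological_tendstoD[of _ _ _ "interior U"])
    then show "x \<in> (\<Union>n\<in>UNIV. W n)"
      by (auto dest: eventually_happens)
  qed
  ultimately obtain J where J: "finite J" "C \<subseteq> (\<Union>n\<in>J. W n)"
    using compactE_image[OF assms, of UNIV W] by auto
  define m where "m = Max (insert 0 J)"
  have "inverse (real (Suc m)) *\<^sub>R x \<in> V" if x: "x \<in> C" for x
  proof -
    obtain n where n: "n \<in> J" "x \<in> W n"
      using J x by blast
    then have "n \<le> m" "inverse (real (Suc n)) *\<^sub>R x \<in> U"
      using J interior_subset by (auto simp: m_def W_def)
    then have "inverse (real (Suc m)) *\<^sub>R x \<in> U"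
      using cbalancedD_le[OF U(2), of "of_real (inverse (real (Suc n)))" x "of_real (inverse (real (Suc m)))"]
      unfolding scaleR_scaleC norm_of_real by (simp add: field_simps)
    then show ?thesis using U(3) by blast
  qed
  then have "C \<subseteq> (\<lambda>x. real (Suc m) *\<^sub>R x) ` V"
    by (auto simp: mem_scaleR_image simp del: of_nat_Suc)
  then show "\<exists>\<alpha>>0. C \<subseteq> (\<lambda>x. \<alpha> *\<^sub>R x) ` V"
    by (intro exI[of _ "real (Suc m)"]) simp
qed

text \<open>The space need not be first countable, so compactness need not provide convergent
  subsequences. A proper filter finer than \<open>sequentially\<close> takes their place.\<close>

lemma compact_cluster_filter:
  assumes "compact S" and f: "\<And>n::nat. f n \<in> S"
  obtains l G where "l \<in> S" "G \<noteq> bot" "G \<le> sequentially" "(f \<longlongrightarrow> l) G"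
proof -
  have "filtermap f sequentially \<noteq> bot"
    by (simp add: filtermap_bot_iff)
  then obtain l where l: "l \<in> S" "inf (nhds l) (filtermap f sequentially) \<noteq> bot"
    using assms by (auto simp: compact_filter eventually_filtermap)
  define G where "G = inf sequentially (filtercomap f (nhds l))"
  have "G \<noteq> bot"
  proof
    assume "G = bot"
    then have "\<forall>\<^sub>F n in G. False"
      by simp
    then obtain P Q where P: "eventually P sequentially" and Q: "eventually Q (nhds l)"
      and PQ: "\<And>n. P n \<Longrightarrow> Q (f n) \<Longrightarrow> False"
      by (auto simp: G_def eventually_inf eventually_filtercomap)
    have "\<forall>\<^sub>F y in filtermap f sequentially. \<not> Q y"
      unfolding eventually_filtermap using P by eventually_elim (use PQ in blast)
    with Q have "\<forall>\<^sub>F y in inf (nhds l) (filtermap f sequentially). False"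
      unfolding eventually_inf by blast
    with l(2) show False
      by (simp add: trivial_limit_def)
  qed
  moreover have "(f \<longlongrightarrow> l) G"
    unfolding G_def by (intro filterlim_inf[THEN iffD2] tendsto_mono[OF inf_le2] filterlim_filtercomap)
  moreover have "G \<le> sequentially"
    by (simp add: G_def)
  ultimately show thesis
    using that l(1) by blast
qed

section \<open>Riesz theory\<close>

text \<open>\<open>q\<close> may vanish on nonzero vectors, so \<open>q\<close>-limits need not be
  unique. Riesz theory works nevertheless because \<open>K\<close> turns \<open>q\<close>-limits
  into limits in the Hausdorff topology.\<close>

locale compact_on_ball = quasi_seminorm q a + K: Vector_Spaces.linear scaleC scaleC K
  for q :: "'a::complex_tvs \<Rightarrow> real" and a and K :: "'a \<Rightarrow> 'a" +
  fixes C :: "'a set"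
  assumes q_nhds: "0 < e \<Longrightarrow> \<forall>\<^sub>F x in nhds 0. q x < e"
    and compact_C: "compact C"
    and K_ball: "q x < 1 \<Longrightarrow> K x \<in> C"
begin

lemma K_scaleR: "K (r *\<^sub>R x) = r *\<^sub>R K x"
  by (simp add: scaleR_scaleC K.scale)

lemma bounded_C: "tvs_bounded C"
  by (rule compact_imp_tvs_bounded[OF compact_C])

lemma q_tendsto_zero:
  assumes "(f \<longlongrightarrow> 0) F"
  shows "((\<lambda>t. q (f t)) \<longlongrightarrow> 0) F"
proof (rule tendstoI)
  fix e :: real assume "0 < e"
  from q_nhds[OF this] show "\<forall>\<^sub>F t in F. dist (q (f t)) 0 < e"
    using assms by (auto simp: filterlim_iff)
qed

text \<open>\<open>C\<close> is bounded, so \<open>K\<close> maps a sufficiently small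
  \<open>q\<close>-ball into any given zero neighborhood.\<close>

lemma K_tendsto_zero:
  assumes "((\<lambda>t. q (f t)) \<longlongrightarrow> 0) F"
  shows "((\<lambda>t. K (f t)) \<longlongrightarrow> 0) F"
proof (rule topological_tendstoI)
  fix S :: "'a set" assume "open S" "0 \<in> S"
  then have "zero_nbhd S"
    by (simp add: zero_nbhd_def interior_open)
  with bounded_C obtain \<alpha> :: real where \<alpha>: "0 < \<alpha>" "\<And>x. x \<in> C \<Longrightarrow> inverse \<alpha> *\<^sub>R x \<in> S"
    by (rule tvs_boundedE) blast
  have "\<forall>\<^sub>F t in F. q (f t) < inverse \<alpha>"
    using assms by (rule order_tendstoD) (use \<alpha> in auto)
  then show "\<forall>\<^sub>F t in F. K (f t) \<in> S"
  proof eventually_elim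
    case (elim t)
    then have "q (\<alpha> *\<^sub>R f t) < 1"
      using \<alpha>(1) by (simp add: scaleR field_simps)
    then have "inverse \<alpha> *\<^sub>R K (\<alpha> *\<^sub>R f t) \<in> S"
      by (intro \<alpha>(2) K_ball)
    then show ?case
      using \<alpha>(1) by (simp add: K_scaleR)
  qed
qed

lemma K_tendsto:
  assumes "((\<lambda>t. q (f t - x)) \<longlongrightarrow> 0) F"
  shows "((\<lambda>t. K (f t)) \<longlongrightarrow> K x) F"
  using tendsto_add[OF K_tendsto_zero[OF assms] tendsto_const[of "K x"]] by (simp add: K.diff)

lemma q_diff_tendsto_zero: "(f \<longlongrightarrow> x) F \<Longrightarrow> ((\<lambda>t. q (f t - x)) \<longlongrightarrow> 0) F"
  using tendsto_diff[of f x F "\<lambda>_. x" x] by (intro q_tendsto_zero) simp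

lemma K_bound:
  obtains L where "0 < L" "\<And>x. q (K x) \<le> L * q x"
proof -
  have "zero_nbhd {x. q x < 1}"
    using q_nhds[of 1] by (simp add: zero_nbhd_iff)
  with bounded_C obtain L :: real where L: "0 < L" "\<And>x. x \<in> C \<Longrightarrow> inverse L *\<^sub>R x \<in> {x. q x < 1}"
    by (rule tvs_boundedE) blast
  have "q (K x) \<le> L * q x" for x
  proof (rule field_le_epsilon)
    fix e :: real assume e: "0 < e"
    define r where "r = q x + e / L"
    have r: "0 < r"
      using e L nonneg[of x] unfolding r_def by (intro add_nonneg_pos) auto
    have "q x < r"
      using e L by (simp add: r_def)
    then have "q (inverse r *\<^sub>R x) < 1"
      using r by (simp add: scaleR field_simps)
    then have "q (inverse L *\<^sub>R K (inverse r *\<^sub>R x)) < 1"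
      using K_ball L(2) by blast
    then have "q (K x) < L * r"
      using r L by (simp add: K_scaleR scaleR field_simps)
    then show "q (K x) \<le> L * q x + e"
      using L by (simp add: r_def distrib_left)
  qed
  then show thesis using that L(1) by blast
qed

text \<open>Otherwise there are vectors of size \<open>1 / 2\<close> almost annihilated by
  \<open>1 - z K\<close>. A cluster point of their images under \<open>K\<close> satisfies the
  eigenvector equation, hence is 0, and then the vectors themselves become \<open>q\<close>-small.
  Clustering in \<open>Z\<close> at the same time makes the constant uniform.\<close>

lemma bounded_below:
  assumes "compact Z" and inj: "\<And>z x. z \<in> Z \<Longrightarrow> x = z *\<^sub>C K x \<Longrightarrow> x = 0"
  obtains M where "0 < M" "\<And>z x. z \<in> Z \<Longrightarrow> q x \<le> M * q (x - z *\<^sub>C K x)"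
proof (rule ccontr)
  assume contr: "\<not> thesis"
  have "\<exists>z x. z \<in> Z \<and> real (Suc n) * q (x - z *\<^sub>C K x) < q x" for n
    using contr that[of "real (Suc n)"] by (force simp: not_le)
  then obtain z x where z: "\<And>n. z n \<in> Z"
    and x: "\<And>n. real (Suc n) * q (x n - z n *\<^sub>C K (x n)) < q (x n)"
    by metis
  \<comment> \<open>Size \<open>1 / 2\<close> keeps \<open>y n\<close> inside the open ball that
    \<open>K\<close> maps into \<open>C\<close>.\<close>
  define y where "y n = inverse (2 * q (x n)) *\<^sub>R x n" for n
  have qx: "0 < q (x n)" for n
    by (rule order.strict_trans1[OF _ x[of n]]) simp
  have qy: "q (y n) = 1 / 2" for n
    using qx[of n] by (simp add: y_def scaleR)
  have small: "q (y n - z n *\<^sub>C K (y n)) \<le> inverse (real (Suc n))" for n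
  proof -
    have "y n - z n *\<^sub>C K (y n) = inverse (2 * q (x n)) *\<^sub>R (x n - z n *\<^sub>C K (x n))"
      by (simp only: y_def K_scaleR scaleC_scaleR_commute scaleR_right_diff_distrib)
    then have "q (y n - z n *\<^sub>C K (y n)) = inverse (2 * q (x n)) * q (x n - z n *\<^sub>C K (x n))"
      using qx[of n] by (simp only: scaleR) simp
    also have "\<dots> \<le> inverse (2 * q (x n)) * (q (x n) / real (Suc n))"
      using x[of n] qx[of n] by (intro mult_left_mono) (simp_all add: field_simps)
    also have "\<dots> = inverse (real (Suc n)) / 2"
      using qx[of n] by (simp add: divide_simps del: of_nat_Suc)
    also have "\<dots> \<le> inverse (real (Suc n))"
      by simp
    finally show ?thesis .
  qed
  have "(z n, K (y n)) \<in> Z \<times> C" for n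
    using z K_ball[of "y n"] by (simp add: qy)
  with compact_Times[OF assms(1) compact_C] obtain l G where G: "G \<noteq> bot" "G \<le> sequentially"
    and l: "l \<in> Z \<times> C" "((\<lambda>n. (z n, K (y n))) \<longlongrightarrow> l) G"
    by (rule compact_cluster_filter)
  have zl: "(z \<longlongrightarrow> fst l) G" and Kl: "((\<lambda>n. K (y n)) \<longlongrightarrow> snd l) G"
    using tendsto_fst[OF l(2)] tendsto_snd[OF l(2)] by simp_all
  have q0: "((\<lambda>n. q (y n - z n *\<^sub>C K (y n))) \<longlongrightarrow> 0) G"
    by (rule tendsto_mono[OF G(2)], rule tendsto_sandwich[OF _ _ tendsto_const LIMSEQ_inverse_real_of_nat])
      (use small in auto)
  \<comment> \<open>Applying \<open>K\<close> to the \<open>q\<close>-small residual gives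
    convergence in the topology, where limits can be compared.\<close>
  have "((\<lambda>n. K (y n) - z n *\<^sub>C K (K (y n))) \<longlongrightarrow> 0) G"
    using K_tendsto_zero[OF q0] by (simp add: K.diff K.scale)
  moreover have "((\<lambda>n. K (y n) - z n *\<^sub>C K (K (y n))) \<longlongrightarrow> snd l - fst l *\<^sub>C K (snd l)) G"
    by (intro tendsto_diff tendsto_scaleC K_tendsto q_diff_tendsto_zero zl Kl)
  ultimately have "snd l - fst l *\<^sub>C K (snd l) = 0"
    by (rule tendsto_unique[OF G(1), symmetric])
  then have eigen: "snd l = fst l *\<^sub>C K (snd l)"
    by (simp only: right_minus_eq)
  have "fst l \<in> Z"
    using l(1) by (simp add: mem_Times_iff)
  from inj[OF this eigen] have "snd l = 0" .
  then have "((\<lambda>n. z n *\<^sub>C K (y n)) \<longlongrightarrow> 0) G"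
    using tendsto_scaleC[OF zl Kl] by simp
  then have "((\<lambda>n. q (z n *\<^sub>C K (y n))) \<longlongrightarrow> 0) G"
    by (rule q_tendsto_zero)
  then have "\<forall>\<^sub>F n in G. q (z n *\<^sub>C K (y n)) < 1 / (2 * a)"
    by (rule order_tendstoD) (use a_ge_1 in auto)
  moreover have "\<forall>\<^sub>F n in G. q (y n - z n *\<^sub>C K (y n)) < 1 / (2 * a)"
    using q0 by (rule order_tendstoD) (use a_ge_1 in auto)
  ultimately have "\<forall>\<^sub>F n in G. False"
  proof eventually_elim
    case (elim n)
    then have "q (z n *\<^sub>C K (y n) + (y n - z n *\<^sub>C K (y n))) < a * (1 / (2 * a))"
      by (rule add_less)
    then show ?case
      using qy[of n] a_ge_1 by simp
  qed
  with G(1) show False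
    by (simp add: trivial_limit_def)
qed

text \<open>Exactly what gives every point outside the set a positive \<open>q\<close>-distance from
  it.\<close>

definition q_closed :: "'a set \<Rightarrow> bool"
  where "q_closed A \<longleftrightarrow> (\<forall>y. (\<forall>e>0. \<exists>b\<in>A. q (y - b) < e) \<longrightarrow> y \<in> A)"

text \<open>Riesz's lemma: \<open>x\<close> attains the distance \<open>d\<close> from
  \<open>y\<close> up to a factor below 2, and normalizing \<open>q (y - x) < 2 * d\<close> to
  \<open>1 / 2\<close> turns \<open>d\<close> into more than \<open>1 / 4\<close> by
  homogeneity.\<close>

lemma riesz_almost_orthogonal:
  assumes A: "q_closed A" "A \<noteq> {}" "\<And>x y. x \<in> A \<Longrightarrow> y \<in> A \<Longrightarrow> x + y \<in> A" "\<And>c x. x \<in> A \<Longrightarrow> c *\<^sub>C x \<in> A"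
    and y: "y \<notin> A"
  obtains r x where "x \<in> A" "q (r *\<^sub>R (y - x)) = 1 / 2" "\<And>b. b \<in> A \<Longrightarrow> 1 / 4 \<le> q (r *\<^sub>R (y - x) - b)"
proof -
  obtain e where e: "0 < e" "\<And>b. b \<in> A \<Longrightarrow> e \<le> q (y - b)"
    using A(1) y unfolding q_closed_def by (meson not_le)
  define d where "d = (INF b\<in>A. q (y - b))"
  have bdd: "bdd_below ((\<lambda>b. q (y - b)) ` A)"
    by (rule bdd_belowI[of _ 0]) auto
  have "e \<le> d"
    unfolding d_def using A(2) e(2) by (intro cINF_greatest)
  then have "d < 2 * d"
    using e(1) by simp
  then obtain x where x: "x \<in> A" "q (y - x) < 2 * d"
    unfolding d_def using cINF_less_iff[OF A(2) bdd] by blast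
  define p where "p = q (y - x)"
  have p: "0 < p" "p < 2 * d"
    using e(1) e(2)[OF x(1)] x(2) by (auto simp: p_def)
  define r where "r = inverse (2 * p)"
  have "q (r *\<^sub>R (y - x)) = 1 / 2"
    using p by (simp add: scaleR r_def p_def)
  moreover have "1 / 4 \<le> q (r *\<^sub>R (y - x) - b)" if "b \<in> A" for b
  proof -
    have "x + of_real (2 * p) *\<^sub>C b \<in> A"
      by (rule A(3)[OF x(1) A(4)[OF that]])
    then have "d \<le> q (y - (x + of_real (2 * p) *\<^sub>C b))"
      unfolding d_def by (rule cINF_lower[OF bdd])
    moreover have "r *\<^sub>R (y - x) - b = r *\<^sub>R (y - (x + of_real (2 * p) *\<^sub>C b))"
      using p unfolding scaleR_scaleC[symmetric] by (simp add: r_def algebra_simps)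
    ultimately have "r * d \<le> q (r *\<^sub>R (y - x) - b)"
      using p by (simp add: scaleR r_def)
    moreover have "1 / 4 \<le> r * d"
      using p by (simp add: r_def field_simps)
    ultimately show ?thesis by linarith
  qed
  ultimately show thesis
    using that x(1) by blast
qed

section \<open>Closed range and surjectivity of \<open>1 - z K\<close>\<close>

context
  fixes z :: complex and S and M :: real
  assumes S_def: "\<And>x. S x = x - z *\<^sub>C K x"
    and M_pos: "0 < M" and S_below: "\<And>x. q x \<le> M * q (S x)"
    and S_inj: "\<And>x. S x = 0 \<Longrightarrow> x = 0"
begin

text \<open>If \<open>S (x n)\<close> approaches \<open>y\<close>, the lower bound keeps
  \<open>x n\<close> bounded in \<open>q\<close>, so \<open>K (x n)\<close> clusters at some
  \<open>w\<close> and \<open>x n\<close> at \<open>y + z w\<close> in the sense of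
  \<open>q\<close>. Since \<open>K\<close> maps this vector to \<open>w\<close>, its image under
  \<open>S\<close> is exactly \<open>y\<close>.\<close>

lemma q_closed_image:
  assumes A: "q_closed A"
  shows "q_closed (S ` A)"
  unfolding q_closed_def
proof safe
  fix y assume y: "\<forall>e>0. \<exists>b\<in>S ` A. q (y - b) < e"
  have "\<exists>x\<in>A. q (y - S x) < inverse (real (Suc n))" for n
    using y[rule_format, of "inverse (real (Suc n))"] by auto
  then obtain x where xA: "\<And>n. x n \<in> A" and x: "\<And>n. q (y - S (x n)) < inverse (real (Suc n))"
    by metis
  \<comment> \<open>The quasi-triangle inequality bounds \<open>q (S (x n))\<close> by
    \<open>a * max (q y) 1\<close>; the summand 1 makes \<open>b\<close> positive and the bound on
    \<open>q (x n)\<close> strict.\<close>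
  define b where "b = M * (a * max (q y) 1) + 1"
  have "0 \<le> M * (a * max (q y) 1)"
    using M_pos a_ge_1 by (intro mult_nonneg_nonneg) auto
  then have b: "0 < b"
    by (simp add: b_def)
  have "q (x n) < b" for n
  proof -
    have "q (y - S (x n)) \<le> 1"
      using x[of n] by (rule less_imp_le[OF order.strict_trans2]) (simp add: field_simps)
    then have "q (y - (y - S (x n))) \<le> a * max (q y) 1"
      by (intro diff_le) auto
    then have "M * q (S (x n)) \<le> M * (a * max (q y) 1)"
      using M_pos by simp
    then show ?thesis
      using S_below[of "x n"] by (simp add: b_def)
  qed
  then have "K (inverse b *\<^sub>R x n) \<in> C" for n
    using b by (intro K_ball) (simp add: scaleR field_simps)
  with compact_C obtain l G where G: "G \<noteq> bot" "G \<le> sequentially"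
    and l: "((\<lambda>n. K (inverse b *\<^sub>R x n)) \<longlongrightarrow> l) G"
    by (rule compact_cluster_filter)
  define w where "w = b *\<^sub>R l"
  have Kw: "((\<lambda>n. K (x n)) \<longlongrightarrow> w) G"
    using tendsto_scaleR_tvs[OF tendsto_const[of b] l] b by (simp add: w_def K_scaleR)
  have "((\<lambda>n. q (y - S (x n))) \<longlongrightarrow> 0) G"
    by (rule tendsto_mono[OF G(2)], rule tendsto_sandwich[OF _ _ tendsto_const LIMSEQ_inverse_real_of_nat])
      (simp_all add: less_imp_le[OF x] del: of_nat_Suc)
  moreover have "((\<lambda>n. q (z *\<^sub>C (K (x n) - w))) \<longlongrightarrow> 0) G"
    using tendsto_mult_right_zero[OF q_diff_tendsto_zero[OF Kw], of "cmod z"] by (simp add: scale)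
  ultimately have "((\<lambda>n. a * (q (y - S (x n)) + q (z *\<^sub>C (K (x n) - w)))) \<longlongrightarrow> 0) G"
    by (intro tendsto_mult_right_zero tendsto_add_zero)
  then have qx: "((\<lambda>n. q (x n - (y + z *\<^sub>C w))) \<longlongrightarrow> 0) G"
  proof (rule tendsto_sandwich[OF _ _ tendsto_const, rotated 2])
    have "q (x n - (y + z *\<^sub>C w)) \<le> a * (q (y - S (x n)) + q (z *\<^sub>C (K (x n) - w)))" for n
    proof -
      have "x n - (y + z *\<^sub>C w) = z *\<^sub>C (K (x n) - w) - (y - S (x n))"
        by (simp add: S_def cvs.scale_right_diff_distrib)
      then show ?thesis
        by (simp only:) (rule diff_le, auto)
    qed
    then show "\<forall>\<^sub>F n in G. q (x n - (y + z *\<^sub>C w)) \<le> a * (q (y - S (x n)) + q (z *\<^sub>C (K (x n) - w)))"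
      by simp
  qed simp
  have "K (y + z *\<^sub>C w) = w"
    using tendsto_unique[OF G(1) K_tendsto[OF qx] Kw] .
  then have "y = S (y + z *\<^sub>C w)"
    by (simp add: S_def)
  moreover have "y + z *\<^sub>C w \<in> A"
  proof (rule A[unfolded q_closed_def, rule_format])
    fix e :: real assume "0 < e"
    then have "\<forall>\<^sub>F n in G. q (x n - (y + z *\<^sub>C w)) < e"
      using order_tendstoD(2)[OF qx] by blast
    then obtain n where "q (x n - (y + z *\<^sub>C w)) < e"
      using eventually_happens' G(1) by blast
    then show "\<exists>b\<in>A. q (y + z *\<^sub>C w - b) < e"
      using xA minus[of "x n - (y + z *\<^sub>C w)"] by (auto intro!: bexI[of _ "x n"])
  qed
  ultimately show "y \<in> S ` A" by blast
qed

text \<open>A point outside the range and injectivity make the ranges of the powers of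
  \<open>S\<close> strictly decreasing. Riesz's lemma gives \<open>v n\<close> in the
  \<open>n\<close>-th range, away from the next one. For \<open>n < m\<close>,
  \<open>z (K (v n) - K (v m))\<close> differs from \<open>v n\<close> by an element of that next
  range, so the \<open>K (v n)\<close> cannot cluster.\<close>

lemma surj_S: "surj S"
proof (rule ccontr)
  assume "\<not> surj S"
  then obtain x0 where x0: "x0 \<notin> range S" by auto
  interpret S: Vector_Spaces.linear scaleC scaleC S
    unfolding clinear_iff S_def
    by (simp add: K.add K.scale cvs.scale_right_distrib cvs.scale_right_diff_distrib mult.commute)
  interpret Sn: Vector_Spaces.linear scaleC scaleC "S ^^ n" for n
    by (rule clinear_funpow) (rule S.linear_axioms)
  define X where "X n = range (S ^^ n)" for n
  have XSuc: "X (Suc n) = S ` X n" for n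
    by (auto simp: X_def image_comp)
  have X_add: "x \<in> X n \<Longrightarrow> y \<in> X n \<Longrightarrow> x + y \<in> X n" for n x y
    unfolding X_def by (auto simp flip: Sn.add)
  have X_scale: "x \<in> X n \<Longrightarrow> c *\<^sub>C x \<in> X n" for n x c
    unfolding X_def by (auto simp flip: Sn.scale)
  have X_diff: "x \<in> X n \<Longrightarrow> y \<in> X n \<Longrightarrow> x - y \<in> X n" for n x y
    unfolding X_def by (auto simp flip: Sn.diff)
  have X_mono: "n \<le> m \<Longrightarrow> X m \<subseteq> X n" for n m
  proof (rule subsetI)
    fix x assume "n \<le> m" "x \<in> X m"
    then obtain y where "x = (S ^^ m) y"
      by (auto simp: X_def)
    also have "\<dots> = (S ^^ n) ((S ^^ (m - n)) y)"
      using \<open>n \<le> m\<close> by (metis comp_apply funpow_add le_add_diff_inverse)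
    finally show "x \<in> X n" by (auto simp: X_def)
  qed
  have X_S: "x \<in> X n \<Longrightarrow> S x \<in> X (Suc n)" for n x
    by (auto simp: XSuc)
  have X_closed: "q_closed (X n)" for n
  proof (induction n)
    case 0
    show ?case by (simp add: X_def q_closed_def)
  next
    case (Suc n)
    then show ?case unfolding XSuc by (rule q_closed_image)
  qed
  have injS: "inj (S ^^ n)" for n
  proof (induction n)
    case (Suc n)
    have "inj S"
      using S_inj by (metis S.diff eq_iff_diff_eq_0 injI)
    then show ?case
      using Suc unfolding funpow.simps by (rule inj_compose)
  qed simp
  have x0n: "(S ^^ n) x0 \<notin> X (Suc n)" for n
    using x0 inj_eq[OF injS[of n]] by (auto simp: X_def funpow_Suc_right simp del: funpow.simps)
  have "\<exists>v. v \<in> X n \<and> q v = 1 / 2 \<and> (\<forall>b\<in>X (Suc n). 1 / 4 \<le> q (v - b))" for n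
  proof -
    obtain r x where x: "x \<in> X (Suc n)"
      and v: "q (r *\<^sub>R ((S ^^ n) x0 - x)) = 1 / 2"
        "\<And>b. b \<in> X (Suc n) \<Longrightarrow> 1 / 4 \<le> q (r *\<^sub>R ((S ^^ n) x0 - x) - b)"
      by (rule riesz_almost_orthogonal[OF X_closed _ X_add X_scale x0n]) (auto simp: X_def)
    have "r *\<^sub>R ((S ^^ n) x0 - x) \<in> X n"
      unfolding scaleR_scaleC using x X_mono[of n "Suc n"]
      by (intro X_scale X_diff) (auto simp: X_def)
    with v show ?thesis by blast
  qed
  then obtain v where v: "\<And>n. v n \<in> X n" "\<And>n. q (v n) = 1 / 2"
    and far: "\<And>n b. b \<in> X (Suc n) \<Longrightarrow> 1 / 4 \<le> q (v n - b)"
    by metis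
  have "K (v n) \<in> C" for n
    using v(2)[of n] by (intro K_ball) simp
  with compact_C obtain l G where G: "G \<noteq> bot" "G \<le> sequentially"
    and l: "((\<lambda>n. K (v n)) \<longlongrightarrow> l) G"
    by (rule compact_cluster_filter)
  have "((\<lambda>n. q (z *\<^sub>C (K (v n) - l))) \<longlongrightarrow> 0) G"
    using tendsto_mult_right_zero[OF q_diff_tendsto_zero[OF l], of "cmod z"] by (simp add: scale)
  \<comment> \<open>Two vectors this close to zero differ by less than \<open>1 / 4\<close> in
    \<open>q\<close>, the separation of the \<open>v n\<close>.\<close>
  then have near: "\<forall>\<^sub>F n in G. q (z *\<^sub>C (K (v n) - l)) < 1 / (4 * a)"
    by (rule order_tendstoD) (use a_ge_1 in auto)
  then obtain n where n: "q (z *\<^sub>C (K (v n) - l)) < 1 / (4 * a)"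
    using eventually_happens' G(1) by blast
  have "\<forall>\<^sub>F m in G. n < m"
    using G(2) eventually_gt_at_top[of n] by (auto simp: le_filter_def)
  with near have "\<forall>\<^sub>F m in G. q (z *\<^sub>C (K (v m) - l)) < 1 / (4 * a) \<and> n < m"
    by eventually_elim simp
  then obtain m where m: "q (z *\<^sub>C (K (v m) - l)) < 1 / (4 * a)" "n < m"
    using eventually_happens' G(1) by blast
  have "q (z *\<^sub>C (K (v n) - l) - z *\<^sub>C (K (v m) - l)) < a * (1 / (4 * a))"
    using n m(1) by (rule diff_less)
  moreover have "z *\<^sub>C (K (v n) - l) - z *\<^sub>C (K (v m) - l) = v n - (S (v n) + (v m - S (v m)))"
    by (simp add: S_def cvs.scale_right_diff_distrib)
  moreover have "S (v n) + (v m - S (v m)) \<in> X (Suc n)"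
    using m(2) v(1) X_S X_mono[of "Suc n" m] X_mono[of "Suc n" "Suc m"]
    by (intro X_add X_diff) auto
  ultimately show False
    using far[of "S (v n) + (v m - S (v m))" n] a_ge_1 by simp
qed

end

lemma resolvent_exists:
  assumes Z: "compact Z" and inj: "\<And>z x. z \<in> Z \<Longrightarrow> x = z *\<^sub>C K x \<Longrightarrow> x = 0"
  obtains g M where "0 < M"
    "\<And>z x. z \<in> Z \<Longrightarrow> g z (x - z *\<^sub>C K x) = x"
    "\<And>z x. z \<in> Z \<Longrightarrow> g z x - z *\<^sub>C K (g z x) = x"
    "\<And>z x. z \<in> Z \<Longrightarrow> q (g z x) \<le> M * q x"
proof -
  obtain M where M: "0 < M" "\<And>z x. z \<in> Z \<Longrightarrow> q x \<le> M * q (x - z *\<^sub>C K x)"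
    using Z inj by (rule bounded_below) blast+
  define S where "S z x = x - z *\<^sub>C K x" for z x
  have S0: "x = 0" if "z \<in> Z" "S z x = 0" for z x
    using inj[OF that(1)] that(2) by (simp add: S_def)
  have "surj (S z)" if "z \<in> Z" for z
    by (rule surj_S[OF S_def M(1)]) (use M(2) S0 that in \<open>auto simp: S_def\<close>)
  then have right: "S z (inv (S z) x) = x" if "z \<in> Z" for z x
    using that by (simp add: surj_f_inv_f)
  have "inj (S z)" if "z \<in> Z" for z
  proof (rule injI)
    fix x y assume "S z x = S z y"
    moreover have "S z (x - y) = S z x - S z y"
      by (simp add: S_def K.diff cvs.scale_right_diff_distrib)
    ultimately have "S z (x - y) = 0"
      by simp
    then show "x = y"
      using S0[OF that] by fastforce
  qed
  then have left: "inv (S z) (S z x) = x" if "z \<in> Z" for z x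
    using that by (simp add: inv_f_f)
  have "q (inv (S z) x) \<le> M * q x" if "z \<in> Z" for z x
    using M(2)[OF that, of "inv (S z) x"] right[OF that, of x] by (simp add: S_def)
  then show thesis
    using that[of M "\<lambda>z. inv (S z)"] M(1) left right unfolding S_def by blast
qed

text \<open>Passing to \<open>T = K / \<rho>\<close> rescales the disc of radius
  \<open>1 / \<rho>\<close>, where the resolvents exist, to the unit disc. With
  \<open>1 - \<eta> = \<rho> / \<nu>\<close>, \<open>exists_small_power\<close> makes some power of
  \<open>K / \<nu>\<close> a \<open>q\<close>-contraction, so all powers decay in
  \<open>q\<close>.\<close>

lemma scaled_power_tendsto_zero:
  assumes \<rho>: "0 < \<rho>" "\<rho> < \<nu>"
    and no_eigen: "\<And>l x. \<rho> \<le> cmod l \<Longrightarrow> K x = l *\<^sub>C x \<Longrightarrow> x = 0"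
    and V: "zero_nbhd V"
  shows "\<forall>\<^sub>F n in sequentially. \<forall>x. q x \<le> 1 \<longrightarrow> scaled_power K \<nu> n x \<in> V"
proof -
  have \<nu>: "0 < \<nu>"
    using \<rho> by simp
  obtain L where L: "0 < L" "\<And>x. q (K x) \<le> L * q x"
    by (rule K_bound) blast
  have inj: "x = 0" if z: "z \<in> cball 0 (1 / \<rho>)" and x: "x = z *\<^sub>C K x" for z x
  proof (cases "z = 0")
    case False
    then have "K x = inverse z *\<^sub>C x"
      using arg_cong[OF x, of "scaleC (inverse z)"] by simp
    moreover have "\<rho> \<le> cmod (inverse z)"
      using z False \<rho> by (simp only: norm_inverse) (simp add: field_simps)
    ultimately show ?thesis
      by (intro no_eigen)
  qed (use x in simp)
  obtain g M where M: "0 < M"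
    and g: "\<And>z x. z \<in> cball 0 (1 / \<rho>) \<Longrightarrow> g z (x - z *\<^sub>C K x) = x"
      "\<And>z x. z \<in> cball 0 (1 / \<rho>) \<Longrightarrow> g z x - z *\<^sub>C K (g z x) = x"
      "\<And>z x. z \<in> cball 0 (1 / \<rho>) \<Longrightarrow> q (g z x) \<le> M * q x"
    using compact_cball inj by (rule resolvent_exists) blast+
  define T where "T x = (1 / \<rho>) *\<^sub>R K x" for x
  have disc: "z / of_real \<rho> \<in> cball 0 (1 / \<rho>)" if "cmod z \<le> 1" for z
    using that \<rho> by (simp add: norm_divide divide_right_mono)
  have zT: "z *\<^sub>C T x = (z / of_real \<rho>) *\<^sub>C K x" for z x
    by (simp add: T_def scaleR_scaleC)
  interpret T: Vector_Spaces.linear scaleC scaleC T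
    unfolding clinear_iff T_def
    by (simp add: K.add K.scale scaleR_right_distrib scaleC_scaleR_commute)
  interpret resolvent_family q a T "\<lambda>z. g (z / of_real \<rho>)" "L / \<rho>" M
  proof
    show "0 \<le> L / \<rho>" "0 \<le> M"
      using L M \<rho> by simp_all
    show "q (T x) \<le> L / \<rho> * q x" for x
      using divide_right_mono[OF L(2)[of x], of \<rho>] \<rho> by (simp add: T_def scaleR)
    fix z x assume "cmod z \<le> 1"
    note z = disc[OF this]
    show "g (z / of_real \<rho>) (x - z *\<^sub>C T x) = x"
      unfolding zT by (rule g(1)[OF z])
    show "g (z / of_real \<rho>) x - z *\<^sub>C T (g (z / of_real \<rho>) x) = x"
      unfolding zT by (rule g(2)[OF z])
    show "q (g (z / of_real \<rho>) x) \<le> M * q x"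
      by (rule g(3)[OF z])
  qed
  have "0 < 1 - \<rho> / \<nu>" "1 - \<rho> / \<nu> \<le> 1"
    using \<rho> by auto
  from exists_small_power[OF this] obtain N
    where N: "0 < N" "\<And>x. (\<rho> / \<nu>) ^ N * q ((T ^^ N) x) \<le> q x / 2"
    by auto
  have KT: "q ((T ^^ n) x) = q ((K ^^ n) x) / \<rho> ^ n" for n x
  proof -
    have "(T ^^ n) x = (1 / \<rho> ^ n) *\<^sub>R (K ^^ n) x"
      by (induction n) (simp_all add: T_def K_scaleR)
    then show ?thesis
      using \<rho> by (simp add: scaleR)
  qed
  have KN: "q ((K ^^ N) x) / \<nu> ^ N \<le> 1 / 2 * q x" for x
    using N(2)[of x] \<rho> by (simp add: KT power_divide)
  have KNj: "q (((K ^^ N) ^^ j) x) / (\<nu> ^ N) ^ j \<le> (1 / 2) ^ j * q x" for j x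
  proof (induction j)
    case (Suc j)
    have "q (((K ^^ N) ^^ Suc j) x) / (\<nu> ^ N) ^ Suc j
        = q ((K ^^ N) (((K ^^ N) ^^ j) x)) / \<nu> ^ N / (\<nu> ^ N) ^ j"
      by simp
    also have "\<dots> \<le> 1 / 2 * q (((K ^^ N) ^^ j) x) / (\<nu> ^ N) ^ j"
      using \<nu> by (intro divide_right_mono KN) auto
    also have "\<dots> \<le> 1 / 2 * ((1 / 2) ^ j * q x)"
      using Suc by simp
    finally show ?case by simp
  qed simp
  define D where "D = max 1 (L / \<nu>) ^ N"
  have D: "1 \<le> D"
    by (simp add: D_def)
  have Ki: "q ((K ^^ i) x) / \<nu> ^ i \<le> max 1 (L / \<nu>) ^ i * q x" for i x
  proof (induction i)
    case (Suc i)
    have "q ((K ^^ Suc i) x) / \<nu> ^ Suc i = q (K ((K ^^ i) x)) / \<nu> / \<nu> ^ i"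
      by simp
    also have "\<dots> \<le> (L * q ((K ^^ i) x)) / \<nu> / \<nu> ^ i"
      using \<nu> by (intro divide_right_mono L) auto
    also have "\<dots> = (L / \<nu>) * (q ((K ^^ i) x) / \<nu> ^ i)"
      by simp
    also have "\<dots> \<le> max 1 (L / \<nu>) * (max 1 (L / \<nu>) ^ i * q x)"
      using \<nu> L(1) Suc by (intro mult_mono) auto
    finally show ?case by simp
  qed simp
  \<comment> \<open>With \<open>n = i + N j\<close>, each of the \<open>j\<close> blocks halves
    \<open>q\<close>, while the remaining \<open>i < N\<close> factors cost at most
    \<open>D\<close>.\<close>
  have decay: "q ((K ^^ n) x) / \<nu> ^ n \<le> D * (1 / 2) ^ (n div N) * q x" for n x
  proof -
    define i j where "i = n mod N" and "j = n div N"
    have n: "n = i + N * j"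
      by (simp add: i_def j_def)
    have "(K ^^ n) x = (K ^^ i) (((K ^^ N) ^^ j) x)"
      unfolding n by (simp add: funpow_add funpow_mult)
    then have "q ((K ^^ n) x) / \<nu> ^ n = q ((K ^^ i) (((K ^^ N) ^^ j) x)) / \<nu> ^ i / (\<nu> ^ N) ^ j"
      by (simp add: n power_add power_mult)
    also have "\<dots> \<le> max 1 (L / \<nu>) ^ i * q (((K ^^ N) ^^ j) x) / (\<nu> ^ N) ^ j"
      using \<nu> by (intro divide_right_mono Ki) auto
    also have "\<dots> = max 1 (L / \<nu>) ^ i * (q (((K ^^ N) ^^ j) x) / (\<nu> ^ N) ^ j)"
      by simp
    also have "\<dots> \<le> D * ((1 / 2) ^ j * q x)"
      unfolding D_def using N(1) \<nu>
      by (intro mult_mono KNj power_increasing) (auto simp: i_def intro: less_imp_le)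
    finally show ?thesis
      by (simp add: j_def mult.assoc)
  qed
  obtain \<alpha> :: real where \<alpha>: "0 < \<alpha>" "\<And>x. x \<in> C \<Longrightarrow> inverse \<alpha> *\<^sub>R x \<in> V"
    using bounded_C V by (rule tvs_boundedE) blast
  have "(\<lambda>n. (\<alpha> / \<nu> * D) * (1 / 2) ^ (n div N)) \<longlonglongrightarrow> 0"
    using filterlim_compose[OF LIMSEQ_power_zero filterlim_at_top_div_const_nat[OF N(1)], of "1 / 2 :: real"]
    by (intro tendsto_mult_right_zero) simp
  then have "\<forall>\<^sub>F n in sequentially. (\<alpha> / \<nu> * D) * (1 / 2) ^ (n div N) < 1"
    by (rule order_tendstoD) simp
  \<comment> \<open>One application of \<open>K\<close> is split off to pass from smallness in
    \<open>q\<close> to membership in \<open>V\<close>.\<close>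
  then have "\<forall>\<^sub>F n in sequentially. \<forall>x. q x \<le> 1 \<longrightarrow> scaled_power K \<nu> (Suc n) x \<in> V"
  proof eventually_elim
    case (elim n)
    show ?case
    proof safe
      fix x assume x: "q x \<le> 1"
      have "q ((\<alpha> / \<nu> ^ Suc n) *\<^sub>R (K ^^ n) x) = \<alpha> / \<nu> * (q ((K ^^ n) x) / \<nu> ^ n)"
        using \<alpha>(1) \<nu> by (simp add: scaleR)
      also have "\<dots> \<le> \<alpha> / \<nu> * (D * (1 / 2) ^ (n div N) * q x)"
        using \<alpha>(1) \<nu> by (intro mult_left_mono decay) auto
      also have "\<dots> \<le> \<alpha> / \<nu> * (D * (1 / 2) ^ (n div N) * 1)"
        using \<alpha>(1) \<nu> D x by (intro mult_left_mono) auto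
      also have "\<dots> < 1"
        using elim by (simp add: mult_ac)
      finally have "inverse \<alpha> *\<^sub>R K ((\<alpha> / \<nu> ^ Suc n) *\<^sub>R (K ^^ n) x) \<in> V"
        by (intro \<alpha>(2) K_ball)
      then show "scaled_power K \<nu> (Suc n) x \<in> V"
        using \<alpha>(1) by (simp add: K_scaleR scaled_power_def)
    qed
  qed
  then show ?thesis
    using eventually_sequentially_Suc[of "\<lambda>n. \<forall>x. q x \<le> 1 \<longrightarrow> scaled_power K \<nu> n x \<in> V"] by blast
qed

end

section \<open>Gauges of balanced pseudo-convex neighborhoods\<close>

text \<open>Balancedness replaces the complex scalar by any real \<open>b\<close> above its modulus
  and 1. Allowing all larger \<open>b\<close> lets the constants of two sets be merged.\<close>

lemma pseudo_convexE:
  assumes "cbalanced U" "pseudo_convex U"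
  obtains a :: real where "1 \<le> a" "\<And>b x y. a \<le> b \<Longrightarrow> x \<in> U \<Longrightarrow> y \<in> U \<Longrightarrow> inverse b *\<^sub>R (x + y) \<in> U"
proof -
  obtain \<alpha> where \<alpha>: "U + U \<subseteq> (\<lambda>x. \<alpha> *\<^sub>C x) ` U"
    using assms(2) unfolding pseudo_convex_def by blast
  have *: "inverse b *\<^sub>R (x + y) \<in> U" if b: "max 1 (cmod \<alpha>) \<le> b" and xy: "x \<in> U" "y \<in> U" for b x y
  proof -
    obtain u where u: "u \<in> U" "x + y = \<alpha> *\<^sub>C u"
      using \<alpha> xy by (auto simp: set_plus_def)
    have "inverse b * cmod \<alpha> \<le> 1"
      using b by (simp add: field_simps)
    then have "cmod (of_real (inverse b) * \<alpha>) \<le> 1"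
      using b by (simp add: norm_mult norm_inverse)
    have "inverse b *\<^sub>R (x + y) = (of_real (inverse b) * \<alpha>) *\<^sub>C u"
      by (simp add: u(2) scaleR_scaleC)
    also have "\<dots> \<in> U"
      by (intro cbalancedD[OF assms(1)] u(1)) fact
    finally show ?thesis .
  qed
  show thesis
    by (rule that[of "max 1 (cmod \<alpha>)"]) (simp, rule *)
qed

lemma convex_imp_pseudo_convex:
  fixes U :: "'a::complex_vector set"
  assumes "convex U"
  shows "pseudo_convex U"
  unfolding pseudo_convex_def
proof (intro exI subsetI)
  fix z assume "z \<in> U + U"
  then obtain x y where xy: "z = x + y" "x \<in> U" "y \<in> U"
    by (auto simp: set_plus_def)
  then have "(1 / 2) *\<^sub>R x + (1 / 2) *\<^sub>R y \<in> U"
    using assms by (intro convexD) auto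
  then have "(1 / 2) *\<^sub>R z \<in> U"
    by (simp add: xy scaleR_right_distrib)
  moreover have "(1 / 2) *\<^sub>R z = inverse 2 *\<^sub>C z"
    by (simp add: scaleR_scaleC)
  ultimately show "z \<in> (\<lambda>x. 2 *\<^sub>C x) ` U"
    by (simp add: mem_scaleC_image)
qed

definition minkowski_gauge :: "'a::complex_tvs set \<Rightarrow> 'a \<Rightarrow> real"
  where "minkowski_gauge U x = Inf {t. 0 < t \<and> inverse t *\<^sub>R x \<in> U}"

lemma gauge_le: "0 < t \<Longrightarrow> inverse t *\<^sub>R x \<in> U \<Longrightarrow> minkowski_gauge U x \<le> t"
  unfolding minkowski_gauge_def by (rule cInf_lower) (auto intro: bdd_belowI[of _ 0])

lemma gauge_less:
  fixes U :: "'a::complex_tvs set"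
  assumes U: "zero_nbhd U" "cbalanced U" and x: "minkowski_gauge U x < t"
  shows "0 < t" "inverse t *\<^sub>R x \<in> U"
proof -
  obtain s :: real where "0 < s" "x \<in> (\<lambda>y. s *\<^sub>R y) ` U"
    by (rule zero_nbhd_absorbing[OF U(1)])
  then have "{t. 0 < t \<and> inverse t *\<^sub>R x \<in> U} \<noteq> {}"
    by (auto simp: mem_scaleR_image)
  from cInf_lessD[OF this x[unfolded minkowski_gauge_def]] obtain r
    where r: "0 < r" "inverse r *\<^sub>R x \<in> U" "r < t"
    by auto
  then show "0 < t" by simp
  then show "inverse t *\<^sub>R x \<in> U"
    using cbalancedD_le[OF U(2), of "of_real (inverse r)" x "of_real (inverse t)"] r
    unfolding scaleR_scaleC norm_of_real by simp
qed

text \<open>Balancedness absorbs the phase of \<open>c\<close>. For nonzero \<open>c\<close> the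
  reverse inequality follows by applying this one to \<open>inverse c\<close>.\<close>

lemma gauge_scaleC_le:
  fixes U :: "'a::complex_tvs set"
  assumes U: "zero_nbhd U" "cbalanced U"
  shows "minkowski_gauge U (c *\<^sub>C x) \<le> cmod c * minkowski_gauge U x"
proof (cases "c = 0")
  case True
  have "0 \<in> U"
    using U(1) interior_subset by (auto simp: zero_nbhd_def)
  then have "minkowski_gauge U 0 \<le> t" if "0 < t" for t
    using that by (intro gauge_le) auto
  then have "minkowski_gauge U 0 \<le> 0"
    by (rule field_le_epsilon) simp
  with True show ?thesis by simp
next
  case False
  show ?thesis
  proof (rule dense_ge)
    fix s assume "cmod c * minkowski_gauge U x < s"
    then have "minkowski_gauge U x < s / cmod c"
      using False by (simp add: field_simps)
    note t = gauge_less[OF U this]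
    then have s: "0 < s"
      using False by (simp add: zero_less_divide_iff)
    have "(c / of_real (cmod c)) *\<^sub>C inverse (s / cmod c) *\<^sub>R x \<in> U"
      using False by (intro cbalancedD[OF U(2)] t) (simp add: norm_divide)
    moreover have "(c / of_real (cmod c)) * of_real (inverse (s / cmod c)) = of_real (inverse s) * c"
      using False s by (simp add: field_simps)
    then have "(c / of_real (cmod c)) *\<^sub>C inverse (s / cmod c) *\<^sub>R x = inverse s *\<^sub>R (c *\<^sub>C x)"
      unfolding scaleR_scaleC cvs.scale_scale by (rule arg_cong)
    ultimately show "minkowski_gauge U (c *\<^sub>C x) \<le> s"
      using s by (intro gauge_le) auto
  qed
qed

lemma quasi_seminorm_gauge:
  fixes U :: "'a::complex_tvs set"
  assumes U: "zero_nbhd U" "cbalanced U" and a: "1 \<le> a"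
    "\<And>x y. x \<in> U \<Longrightarrow> y \<in> U \<Longrightarrow> inverse a *\<^sub>R (x + y) \<in> U"
  shows "quasi_seminorm (minkowski_gauge U) a"
proof
  show "1 \<le> a" by (rule a(1))
  show "minkowski_gauge U (c *\<^sub>C x) = cmod c * minkowski_gauge U x" for c x
  proof (cases "c = 0")
    case True
    have "minkowski_gauge U 0 \<le> 0"
      using gauge_scaleC_le[OF U, of 0 0] by simp
    moreover have "0 \<le> minkowski_gauge U 0"
    proof (rule ccontr)
      assume "\<not> 0 \<le> minkowski_gauge U 0"
      then show False
        using gauge_less(1)[OF U, of 0 0] by simp
    qed
    ultimately show ?thesis using True by simp
  next
    case False
    have "minkowski_gauge U x \<le> cmod (inverse c) * minkowski_gauge U (c *\<^sub>C x)"
      using gauge_scaleC_le[OF U, of "inverse c" "c *\<^sub>C x"] False by simp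
    then have "minkowski_gauge U x \<le> inverse (cmod c) * minkowski_gauge U (c *\<^sub>C x)"
      by (simp only: norm_inverse)
    then have "cmod c * minkowski_gauge U x \<le> minkowski_gauge U (c *\<^sub>C x)"
      using False by (simp add: field_simps)
    with gauge_scaleC_le[OF U, of c x] show ?thesis by simp
  qed
  show "minkowski_gauge U (x + y) \<le> a * max (minkowski_gauge U x) (minkowski_gauge U y)" for x y
  proof (rule dense_ge)
    fix s assume "a * max (minkowski_gauge U x) (minkowski_gauge U y) < s"
    then have "max (minkowski_gauge U x) (minkowski_gauge U y) < s / a"
      using pos_less_divide_eq[of a "max (minkowski_gauge U x) (minkowski_gauge U y)" s] a(1)
      by (simp only: mult.commute)
    then have "minkowski_gauge U x < s / a" "minkowski_gauge U y < s / a"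
      by auto
    note x = gauge_less[OF U this(1)] and y = gauge_less[OF U this(2)]
    have s: "0 < s"
      using x(1) a(1) by (simp add: zero_less_divide_iff)
    have "inverse a *\<^sub>R (inverse (s / a) *\<^sub>R x + inverse (s / a) *\<^sub>R y) \<in> U"
      by (intro a(2) x y)
    moreover have "inverse a * inverse (s / a) = inverse s"
      using a(1) by (simp add: field_simps)
    then have "inverse a *\<^sub>R (inverse (s / a) *\<^sub>R x + inverse (s / a) *\<^sub>R y) = inverse s *\<^sub>R (x + y)"
      by (simp only: scaleR_scaleR scaleR_right_distrib)
    ultimately show "minkowski_gauge U (x + y) \<le> s"
      using s by (intro gauge_le) auto
  qed
qed

section \<open>Adapted bases of zero neighborhoods\<close>

text \<open>Every member lies in a multiple of \<open>U\<close>, so control of an operator on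
  \<open>U\<close> alone carries over to all members. This turns statements about one neighborhood
  into statements in the nn-sense.\<close>

definition adapted_base :: "'a::complex_tvs set set \<Rightarrow> 'a set \<Rightarrow> 'a set set"
  where "adapted_base N U = {V \<inter> (\<lambda>x. c *\<^sub>C x) ` U |V c. V \<in> N \<and> c \<noteq> 0}"

lemma adapted_baseI: "V \<in> N \<Longrightarrow> c \<noteq> 0 \<Longrightarrow> V \<inter> (\<lambda>x. c *\<^sub>C x) ` U \<in> adapted_base N U"
  unfolding adapted_base_def by blast

lemma zero_base_adapted_base:
  fixes N :: "'a::complex_tvs set set"
  assumes N: "zero_base N" and U: "U \<in> N"
  shows "zero_base (adapted_base N U)"
proof -
  have general: "zero_base_general N"
    using N by (simp add: zero_base_def)
  have nbhd: "zero_nbhd V" and bal: "cbalanced V" if "V \<in> N" for V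
    using general that unfolding zero_base_general_def by blast+
  have scale: "(\<lambda>x. c *\<^sub>C x) ` V \<in> N" if "V \<in> N" "c \<noteq> 0" for V and c :: complex
    using general that unfolding zero_base_general_def by blast
  have small: "\<exists>W\<in>N. W \<subseteq> V" if "zero_nbhd V" for V
    using general that unfolding zero_base_general_def by blast
  have double: "\<exists>W\<in>N. W + W \<subseteq> V" if "V \<in> N" for V
    using general that unfolding zero_base_general_def by blast
  have mem: "\<exists>V1\<in>N. \<exists>V2\<in>N. W = V1 \<inter> V2" if "W \<in> adapted_base N U" for W
    using that scale[OF U] unfolding adapted_base_def by blast
  have nbhd': "zero_nbhd W" if "W \<in> adapted_base N U" for W
    using mem[OF that] nbhd zero_nbhd_Int by blast
  have small': "\<exists>W\<in>adapted_base N U. W \<subseteq> V" if V: "zero_nbhd V" for V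
  proof -
    obtain W where "W \<in> N" "W \<subseteq> V"
      using small[OF V] by blast
    then show ?thesis
      by (intro bexI[OF _ adapted_baseI[of W N 1 U]]) auto
  qed
  have bal': "cbalanced W" if "W \<in> adapted_base N U" for W
    using mem[OF that] bal unfolding cbalanced_def by blast
  have scale': "(\<lambda>x. c *\<^sub>C x) ` W \<in> adapted_base N U" if W: "W \<in> adapted_base N U" and c: "c \<noteq> 0" for W c
  proof -
    obtain V b where V: "W = V \<inter> (\<lambda>x. b *\<^sub>C x) ` U" "V \<in> N" "b \<noteq> 0"
      using W unfolding adapted_base_def by blast
    have "inj (\<lambda>x::'a. c *\<^sub>C x)"
      using c by (auto intro!: injI)
    then have "(\<lambda>x. c *\<^sub>C x) ` W = (\<lambda>x. c *\<^sub>C x) ` V \<inter> (\<lambda>x. (c * b) *\<^sub>C x) ` U"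
      by (simp add: V(1) image_Int image_image)
    then show ?thesis
      using adapted_baseI[OF scale[OF V(2) c], of "c * b"] V(3) c by simp
  qed
  have inter': "\<exists>W\<in>adapted_base N U. W \<subseteq> V1 \<inter> V2"
    if "V1 \<in> adapted_base N U" "V2 \<in> adapted_base N U" for V1 V2
    by (rule small'[OF zero_nbhd_Int[OF nbhd'[OF that(1)] nbhd'[OF that(2)]]])
  have double': "\<exists>W\<in>adapted_base N U. W + W \<subseteq> V" if V: "V \<in> adapted_base N U" for V
  proof -
    obtain V' where "V' \<in> N" "V' \<subseteq> V"
      using small nbhd'[OF V] by blast
    moreover then obtain W' where "W' \<in> N" "W' + W' \<subseteq> V'"
      using double by blast
    moreover then obtain W where "W \<in> adapted_base N U" "W \<subseteq> W'"
      using small' nbhd by blast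
    ultimately show ?thesis
      using set_plus_mono2[of W W' W W'] by blast
  qed
  have convex': "convex W" if "locally_convex TYPE('a)" "W \<in> adapted_base N U" for W
  proof -
    have "convex V" if "V \<in> N" for V
      using N \<open>locally_convex TYPE('a)\<close> that by (simp add: zero_base_def)
    then show ?thesis
      using mem[OF that(2)] convex_Int by blast
  qed
  show ?thesis
    unfolding zero_base_def zero_base_general_def
    by (intro conjI ballI allI impI; (rule nbhd' small' bal' scale' inter' double' convex'; assumption))
qed

section \<open>Comparison of the boundedness and convergence notions\<close>

lemma clinear_scaleR: "clinear T \<Longrightarrow> T (r *\<^sub>R x) = r *\<^sub>R T x"
  by (simp add: clinear_iff scaleR_scaleC)

lemma nn_bounded_imp_bb_bounded:
  fixes T :: "'a::complex_tvs \<Rightarrow> 'a"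
  assumes "nn_bounded T"
  shows "bb_bounded T"
proof -
  obtain N where T: "clinear T" and N: "zero_base N"
    and TN: "\<And>U. U \<in> N \<Longrightarrow> \<exists>\<alpha>::real. 0 < \<alpha> \<and> T ` U \<subseteq> (\<lambda>x. \<alpha> *\<^sub>R x) ` U"
    using assms unfolding nn_bounded_def by blast
  interpret T: Vector_Spaces.linear scaleC scaleC T by (rule T)
  have "\<exists>\<alpha>>0. T ` A \<subseteq> (\<lambda>x. \<alpha> *\<^sub>R x) ` V" if A: "tvs_bounded A" and V: "zero_nbhd V" for A V
  proof -
    obtain U where U: "U \<in> N" "U \<subseteq> V"
      using N V unfolding zero_base_def zero_base_general_def by blast
    obtain \<alpha> :: real where \<alpha>: "0 < \<alpha>" "T ` U \<subseteq> (\<lambda>x. \<alpha> *\<^sub>R x) ` U"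
      using TN[OF U(1)] by blast
    have "zero_nbhd U"
      using N U(1) unfolding zero_base_def zero_base_general_def by blast
    with A obtain \<beta> :: real where \<beta>: "0 < \<beta>" "\<And>x. x \<in> A \<Longrightarrow> inverse \<beta> *\<^sub>R x \<in> U"
      by (rule tvs_boundedE) blast
    have "T x \<in> (\<lambda>x. (\<beta> * \<alpha>) *\<^sub>R x) ` V" if "x \<in> A" for x
    proof -
      have "T (inverse \<beta> *\<^sub>R x) \<in> (\<lambda>x. \<alpha> *\<^sub>R x) ` U"
        using \<beta>(2)[OF that] \<alpha>(2) by blast
      then show ?thesis
        using \<alpha>(1) \<beta>(1) U(2) by (auto simp: mem_scaleR_image clinear_scaleR[OF T] mult.commute)
    qed
    then show ?thesis
      using \<alpha>(1) \<beta>(1) by (intro exI[of _ "\<beta> * \<alpha>"]) auto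
  qed
  then show ?thesis
    unfolding bb_bounded_def tvs_bounded_def[of "T ` _"] using T by blast
qed

lemma nn_bounded_imp_c_bounded:
  fixes T :: "'a::complex_tvs \<Rightarrow> 'a"
  assumes "nn_bounded T"
  shows "c_bounded T"
proof -
  obtain N where T: "clinear T" and N: "zero_base N"
    and TN: "\<And>U. U \<in> N \<Longrightarrow> \<exists>\<alpha>::real. 0 < \<alpha> \<and> T ` U \<subseteq> (\<lambda>x. \<alpha> *\<^sub>R x) ` U"
    using assms unfolding nn_bounded_def by blast
  interpret T: Vector_Spaces.linear scaleC scaleC T by (rule T)
  have T0: "(T \<longlongrightarrow> 0) (nhds 0)"
  proof (rule topological_tendstoI)
    fix S :: "'a set" assume "open S" "0 \<in> S"
    then have "zero_nbhd S"
      by (simp add: zero_nbhd_def interior_open)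
    then obtain U where U: "U \<in> N" "U \<subseteq> S"
      using N unfolding zero_base_def zero_base_general_def by blast
    obtain \<alpha> :: real where \<alpha>: "0 < \<alpha>" "T ` U \<subseteq> (\<lambda>x. \<alpha> *\<^sub>R x) ` U"
      using TN[OF U(1)] by blast
    have "zero_nbhd U"
      using N U(1) unfolding zero_base_def zero_base_general_def by blast
    then have "\<forall>\<^sub>F x in nhds 0. x \<in> (\<lambda>x. inverse \<alpha> *\<^sub>R x) ` U"
      using zero_nbhd_scaleR[of U "inverse \<alpha>"] \<alpha>(1) by (simp add: zero_nbhd_iff)
    then show "\<forall>\<^sub>F x in nhds 0. T x \<in> S"
    proof eventually_elim
      case (elim x)
      then have "T (\<alpha> *\<^sub>R x) \<in> (\<lambda>x. \<alpha> *\<^sub>R x) ` U"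
        using \<alpha> by (auto simp: mem_scaleR_image)
      then show ?case
        using \<alpha>(1) U(2) by (auto simp: mem_scaleR_image clinear_scaleR[OF T])
    qed
  qed
  have "continuous_on UNIV T"
    unfolding continuous_on_def
  proof
    fix x :: 'a
    have "((\<lambda>y. y - x) \<longlongrightarrow> 0) (at x)"
      using tendsto_diff[OF tendsto_ident_at[of x UNIV] tendsto_const[of x]] by simp
    from tendsto_add[OF filterlim_compose[OF T0 this] tendsto_const[of "T x"]]
    show "(T \<longlongrightarrow> T x) (at x)"
      by (simp add: T.diff)
  qed
  with T show ?thesis by (simp add: c_bounded_def)
qed

text \<open>
  Pseudo-convexity of the members is what makes the scalar part harmless:
  \<open>\<alpha> W + S W \<subseteq> \<beta> (W + W)\<close>.
\<close>

lemma nn_bounded_scalar_plus_nb: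
  fixes N :: "'a::complex_tvs set set" and S :: "'a \<Rightarrow> 'a"
  assumes N: "zero_base N" "\<And>U. U \<in> N \<Longrightarrow> pseudo_convex U" and S: "nb_bounded S"
  shows "nn_bounded (\<lambda>x. \<alpha> *\<^sub>C x + S x)"
proof -
  obtain U0 where S_lin: "clinear S" and U0: "zero_nbhd U0" "tvs_bounded (S ` U0)"
    using S unfolding nb_bounded_def by blast
  interpret S: Vector_Spaces.linear scaleC scaleC S by (rule S_lin)
  have general: "zero_base_general N"
    using N(1) by (simp add: zero_base_def)
  have bal: "cbalanced V" if "V \<in> N" for V
    using general that unfolding zero_base_general_def by blast
  obtain U where U: "U \<in> N" "U \<subseteq> U0"
    using general U0(1) unfolding zero_base_general_def by blast
  have lin: "clinear (\<lambda>x. \<alpha> *\<^sub>C x + S x)"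
    unfolding clinear_iff
    by (simp add: S.add S.scale cvs.scale_right_distrib mult.commute)
  note base = zero_base_adapted_base[OF N(1) U(1)]
  have "\<exists>\<beta>::real. 0 < \<beta> \<and> (\<lambda>x. \<alpha> *\<^sub>C x + S x) ` W \<subseteq> (\<lambda>x. \<beta> *\<^sub>R x) ` W"
    if W: "W \<in> adapted_base N U" for W
  proof -
    obtain V c where V: "W = V \<inter> (\<lambda>x. c *\<^sub>C x) ` U" "V \<in> N" "c \<noteq> 0"
      using W unfolding adapted_base_def by blast
    have cU: "(\<lambda>x. c *\<^sub>C x) ` U \<in> N"
      using general U(1) V(3) unfolding zero_base_general_def by blast
    have nbhd: "zero_nbhd W" and balW: "cbalanced W"
      using base W unfolding zero_base_def zero_base_general_def by blast+
    obtain a1 where a1: "1 \<le> a1"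
      "\<And>b x y. a1 \<le> b \<Longrightarrow> x \<in> V \<Longrightarrow> y \<in> V \<Longrightarrow> inverse b *\<^sub>R (x + y) \<in> V"
      using pseudo_convexE[OF bal[OF V(2)] N(2)[OF V(2)]] by blast
    obtain a2 where a2: "1 \<le> a2"
      "\<And>b x y. a2 \<le> b \<Longrightarrow> x \<in> (\<lambda>x. c *\<^sub>C x) ` U \<Longrightarrow> y \<in> (\<lambda>x. c *\<^sub>C x) ` U \<Longrightarrow>
        inverse b *\<^sub>R (x + y) \<in> (\<lambda>x. c *\<^sub>C x) ` U"
      using pseudo_convexE[OF bal[OF cU] N(2)[OF cU]] by blast
    define b where "b = max a1 a2"
    have b: "1 \<le> b" "x \<in> W \<Longrightarrow> y \<in> W \<Longrightarrow> inverse b *\<^sub>R (x + y) \<in> W" for x y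
      using a1 a2 unfolding b_def V(1) by auto
    \<comment> \<open>\<open>S\<close> is controlled on \<open>U0\<close>, which contains
      \<open>inverse c\<close> times \<open>W\<close>; the target is shrunk by the same scalar, so
      scaling back by \<open>c\<close> lands in a multiple of \<open>W\<close>.\<close>
    obtain \<gamma> :: real where \<gamma>: "0 < \<gamma>" "\<And>y. y \<in> S ` U0 \<Longrightarrow> inverse \<gamma> *\<^sub>R y \<in> (\<lambda>x. inverse c *\<^sub>C x) ` W"
    proof (rule tvs_boundedE[OF U0(2)])
      show "zero_nbhd ((\<lambda>x. inverse c *\<^sub>C x) ` W)"
      proof -
        have "(\<lambda>x. inverse c *\<^sub>C x) ` W \<in> adapted_base N U"
          using base W V(3) unfolding zero_base_def zero_base_general_def by simp
        then show ?thesis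
          using base unfolding zero_base_def zero_base_general_def by blast
      qed
    qed blast
    define \<delta> where "\<delta> = max (max 1 (cmod \<alpha>)) \<gamma>"
    have \<delta>: "0 < \<delta>" "cmod \<alpha> \<le> \<delta>" "\<gamma> \<le> \<delta>"
      by (auto simp: \<delta>_def)
    have "\<alpha> *\<^sub>C x + S x \<in> (\<lambda>x. (b * \<delta>) *\<^sub>R x) ` W" if x: "x \<in> W" for x
    proof -
      have "inverse \<delta> * cmod \<alpha> \<le> 1"
        using \<delta> by (simp add: field_simps)
      then have "(of_real (inverse \<delta>) * \<alpha>) *\<^sub>C x \<in> W"
        using \<delta>(1) by (intro cbalancedD[OF balW] x) (simp add: norm_mult norm_inverse)
      then have 1: "inverse \<delta> *\<^sub>R (\<alpha> *\<^sub>C x) \<in> W"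
        by (simp add: scaleR_scaleC)
      have "inverse c *\<^sub>C x \<in> U0"
        using x V U(2) by (auto simp: mem_scaleC_image)
      then have "inverse \<gamma> *\<^sub>R S (inverse c *\<^sub>C x) \<in> (\<lambda>x. inverse c *\<^sub>C x) ` W"
        by (intro \<gamma>(2)) blast
      then have "inverse \<gamma> *\<^sub>R S x \<in> W"
        using V(3) by (simp add: mem_scaleC_image S.scale scaleC_scaleR_commute)
      then have 2: "inverse \<delta> *\<^sub>R S x \<in> W"
        unfolding scaleR_scaleC by (rule cbalancedD_le[OF balW]) (use \<delta> \<gamma>(1) in \<open>simp add: norm_inverse\<close>)
      have "inverse b *\<^sub>R (inverse \<delta> *\<^sub>R (\<alpha> *\<^sub>C x) + inverse \<delta> *\<^sub>R S x) \<in> W"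
        by (rule b(2)[OF 1 2])
      then show ?thesis
        using b(1) \<delta>(1) by (simp add: mem_scaleR_image scaleR_right_distrib mult.commute)
    qed
    then show ?thesis
      using b(1) \<delta>(1) by (intro exI[of _ "b * \<delta>"]) auto
  qed
  then show ?thesis
    unfolding nn_bounded_def using lin base by blast
qed

lemma null_nn_imp_null_c:
  assumes "null_nn S"
  shows "null_c S"
  unfolding null_c_def
proof (intro allI impI)
  fix V :: "'a set" assume V: "zero_nbhd V"
  obtain N where N: "zero_base N" and S: "\<And>U \<epsilon>::real. U \<in> N \<Longrightarrow> 0 < \<epsilon> \<Longrightarrow>
      \<forall>\<^sub>F n in sequentially. S n ` U \<subseteq> (\<lambda>x. \<epsilon> *\<^sub>R x) ` U"
    using assms unfolding null_nn_def by blast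
  obtain U where U: "U \<in> N" "U \<subseteq> V" "zero_nbhd U"
    using N V unfolding zero_base_def zero_base_general_def by meson
  have "\<forall>\<^sub>F n in sequentially. S n ` U \<subseteq> (\<lambda>x. \<epsilon> *\<^sub>R x) ` V" if "0 < \<epsilon>" for \<epsilon> :: real
    using S[OF U(1) that] by eventually_elim (use U(2) in blast)
  with U(3) show "\<exists>U. zero_nbhd U \<and>
      (\<forall>\<epsilon>::real. 0 < \<epsilon> \<longrightarrow> (\<forall>\<^sub>F n in sequentially. S n ` U \<subseteq> (\<lambda>x. \<epsilon> *\<^sub>R x) ` V))"
    by blast
qed

text \<open>A bounded set lies in \<alpha> times \<open>U\<close>; taking
  \<open>\<epsilon> = inverse \<alpha>\<close> offsets this dilation.\<close>

lemma null_c_imp_null_bb: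
  assumes S: "\<And>n. clinear (S n)" and "null_c S"
  shows "null_bb S"
  unfolding null_bb_def null_uniformly_on_def
proof (intro allI impI)
  fix A V :: "'a set" assume A: "tvs_bounded A" and V: "zero_nbhd V"
  obtain U where U: "zero_nbhd U" and SU: "\<And>\<epsilon>::real. 0 < \<epsilon> \<Longrightarrow>
      \<forall>\<^sub>F n in sequentially. S n ` U \<subseteq> (\<lambda>x. \<epsilon> *\<^sub>R x) ` V"
    using assms(2) V unfolding null_c_def by blast
  obtain \<alpha> :: real where \<alpha>: "0 < \<alpha>" "\<And>x. x \<in> A \<Longrightarrow> inverse \<alpha> *\<^sub>R x \<in> U"
    using A U by (rule tvs_boundedE) blast
  have "\<forall>\<^sub>F n in sequentially. S n ` U \<subseteq> (\<lambda>x. inverse \<alpha> *\<^sub>R x) ` V"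
    using \<alpha>(1) by (intro SU) simp
  then show "\<forall>\<^sub>F n in sequentially. S n ` A \<subseteq> V"
  proof eventually_elim
    case (elim n)
    show ?case
    proof safe
      fix x assume "x \<in> A"
      then have "S n (inverse \<alpha> *\<^sub>R x) \<in> (\<lambda>x. inverse \<alpha> *\<^sub>R x) ` V"
        using \<alpha>(2) elim by blast
      then show "S n x \<in> V"
        using \<alpha>(1) by (simp add: mem_scaleR_image clinear_scaleR[OF S])
    qed
  qed
qed

lemma null_nb_imp_null_bb:
  assumes S: "\<And>n. clinear (S n)" and "null_nb S"
  shows "null_bb S"
proof (rule null_c_imp_null_bb[OF S])
  obtain U where U: "zero_nbhd U" and SU: "\<And>V. zero_nbhd V \<Longrightarrow> \<forall>\<^sub>F n in sequentially. S n ` U \<subseteq> V"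
    using assms(2) unfolding null_nb_def null_uniformly_on_def by blast
  have "\<forall>\<^sub>F n in sequentially. S n ` U \<subseteq> (\<lambda>x. \<epsilon> *\<^sub>R x) ` V" if "zero_nbhd V" "0 < \<epsilon>"
    for V and \<epsilon> :: real
    using that by (intro SU zero_nbhd_scaleR) auto
  with U show "null_c S"
    unfolding null_c_def by blast
qed

text \<open>A member \<open>W\<close> lies in \<open>c\<close> times \<open>U\<close>, and
  \<open>S n\<close> eventually maps \<open>U\<close> into \<epsilon> times \<open>inverse c\<close>
  times \<open>W\<close>; linearity cancels \<open>c\<close>.\<close>

lemma null_nn_of_null_uniformly_on:
  assumes N: "zero_base N" and U: "U \<in> N" and S: "\<And>n. clinear (S n)"
    and null: "null_uniformly_on U S"
  shows "null_nn S"
  unfolding null_nn_def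
proof (intro exI[of _ "adapted_base N U"] conjI ballI allI impI)
  show base: "zero_base (adapted_base N U)"
    by (rule zero_base_adapted_base[OF N U])
  fix W and \<epsilon> :: real assume W: "W \<in> adapted_base N U" and \<epsilon>: "0 < \<epsilon>"
  obtain V c where V: "W = V \<inter> (\<lambda>x. c *\<^sub>C x) ` U" "V \<in> N" "c \<noteq> 0"
    using W unfolding adapted_base_def by blast
  have "(\<lambda>x. inverse c *\<^sub>C x) ` W \<in> adapted_base N U"
    using base W V(3) unfolding zero_base_def zero_base_general_def by simp
  then have "zero_nbhd ((\<lambda>x. inverse c *\<^sub>C x) ` W)"
    using base unfolding zero_base_def zero_base_general_def by blast
  then have "zero_nbhd ((\<lambda>x. \<epsilon> *\<^sub>R x) ` (\<lambda>x. inverse c *\<^sub>C x) ` W)"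
    using \<epsilon> by (intro zero_nbhd_scaleR) auto
  then have "\<forall>\<^sub>F n in sequentially. S n ` U \<subseteq> (\<lambda>x. \<epsilon> *\<^sub>R x) ` (\<lambda>x. inverse c *\<^sub>C x) ` W"
    using null unfolding null_uniformly_on_def by blast
  then show "\<forall>\<^sub>F n in sequentially. S n ` W \<subseteq> (\<lambda>x. \<epsilon> *\<^sub>R x) ` W"
  proof eventually_elim
    case (elim n)
    show ?case
    proof
      fix y assume "y \<in> S n ` W"
      then obtain u where u: "u \<in> U" "y = S n (c *\<^sub>C u)"
        using V(1) by auto
      obtain w where w: "w \<in> W" "S n u = \<epsilon> *\<^sub>R (inverse c *\<^sub>C w)"
        using elim u(1) by blast
      have "y = \<epsilon> *\<^sub>R w"
        using V(3) S[of n] by (simp add: u(2) w(2) clinear_iff scaleR_scaleC mult.left_commute)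
      then show "y \<in> (\<lambda>x. \<epsilon> *\<^sub>R x) ` W"
        using w(1) by blast
    qed
  qed
qed

section \<open>Eigenvalues, spectra and spectral radii\<close>

lemma clinear_scaled_power:
  assumes "clinear T"
  shows "clinear (scaled_power T \<nu> n)"
  using clinear_funpow[OF assms, of n]
  by (simp add: clinear_iff scaled_power_def scaleR_scaleC cvs.scale_right_distrib mult.commute)

text \<open>The scaled powers multiply \<open>x\<close> by powers of \<open>l / \<nu>\<close>. If
  this ratio exceeded 1 in modulus, a balanced neighborhood reached by them would contain
  \<open>x\<close>, although it was chosen to miss \<open>x\<close>.\<close>

lemma eigenvalue_le_of_null_bb:
  fixes T :: "'a::complex_tvs \<Rightarrow> 'a"
  assumes T: "clinear T" and x: "T x = l *\<^sub>C x" "x \<noteq> 0"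
    and \<nu>: "0 < \<nu>" and null: "null_bb (scaled_power T \<nu>)"
  shows "cmod l \<le> \<nu>"
proof (rule ccontr)
  assume l: "\<not> cmod l \<le> \<nu>"
  obtain S where "open S" "0 \<in> S" "x \<notin> S"
    using t1_space[of 0 x] x(2) by auto
  then have "zero_nbhd S"
    by (simp add: zero_nbhd_def interior_open)
  then obtain V where V: "zero_nbhd V" "cbalanced V" "V \<subseteq> S"
    by (rule zero_nbhd_balanced_core)
  have "tvs_bounded {x}"
    by (intro compact_imp_tvs_bounded) simp
  then have "\<forall>\<^sub>F n in sequentially. scaled_power T \<nu> n ` {x} \<subseteq> V"
    using null V(1) unfolding null_bb_def null_uniformly_on_def by blast
  then obtain n where n: "scaled_power T \<nu> n x \<in> V"
    by (auto dest: eventually_happens)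
  have "(T ^^ n) x = l ^ n *\<^sub>C x"
    using T x(1) by (induction n) (simp_all add: clinear_iff mult.commute)
  then have "(l / of_real \<nu>) ^ n *\<^sub>C x \<in> V"
    using n by (simp add: scaled_power_def scaleR_scaleC power_divide)
  then have "1 *\<^sub>C x \<in> V"
    by (rule cbalancedD_le[OF V(2)]) (use l \<nu> in \<open>simp add: norm_power norm_divide\<close>)
  with V(3) \<open>x \<notin> S\<close> show False by auto
qed

text \<open>With \<open>z = inverse l\<close> and \<open>g\<close> the inverse of
  \<open>1 - z K\<close>, the resolvent is \<open>z g = z + z^2 K g\<close>. Its second term is
  nb-bounded: \<open>g\<close> maps a small \<open>q\<close>-ball into the open unit ball, and
  \<open>K\<close> maps that into \<open>C\<close>.\<close>

lemma (in compact_on_ball) nb_resolvent_exists: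
  assumes l: "l \<noteq> 0" and no_eigen: "\<And>x. K x = l *\<^sub>C x \<Longrightarrow> x = 0"
  obtains S where "nb_bounded S" "resolvent_at K l (\<lambda>x. inverse l *\<^sub>C x + S x)"
proof -
  define z where "z = inverse l"
  have zl: "l * z = 1" "z * l = 1"
    using l by (simp_all add: z_def)
  have inj: "x = 0" if "w \<in> {z}" "x = w *\<^sub>C K x" for w x
    using arg_cong[OF that(2), of "scaleC l"] that(1) zl by (intro no_eigen) simp
  obtain g M where M: "0 < M"
    and g: "\<And>w x. w \<in> {z} \<Longrightarrow> g w (x - w *\<^sub>C K x) = x"
      "\<And>w x. w \<in> {z} \<Longrightarrow> g w x - w *\<^sub>C K (g w x) = x"
      "\<And>w x. w \<in> {z} \<Longrightarrow> q (g w x) \<le> M * q x"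
    using compact_sing inj by (rule resolvent_exists) blast+
  note g_left = g(1)[OF singletonI] and g_right = g(2)[OF singletonI] and g_bound = g(3)[OF singletonI]
  define S where "S x = (z * z) *\<^sub>C K (g z x)" for x
  have g_linear: "clinear (g z)"
  proof (rule clinear_inverse)
    show "clinear (\<lambda>x. x - z *\<^sub>C K x)"
      by (simp add: clinear_iff K.add K.scale cvs.scale_right_distrib cvs.scale_right_diff_distrib
          mult.commute)
  qed (rule g_left g_right)+
  have R: "inverse l *\<^sub>C x + S x = z *\<^sub>C g z x" for x
  proof -
    have "z *\<^sub>C g z x = z *\<^sub>C (g z x - z *\<^sub>C K (g z x)) + z *\<^sub>C (z *\<^sub>C K (g z x))"
      by (simp add: cvs.scale_right_diff_distrib)
    then show ?thesis
      by (simp only: g_right) (simp add: S_def z_def)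
  qed
  have "resolvent_at K l (\<lambda>x. inverse l *\<^sub>C x + S x)"
    unfolding resolvent_at_def R
  proof safe
    fix x
    have "l *\<^sub>C x - K x = l *\<^sub>C (x - z *\<^sub>C K x)"
      by (simp add: cvs.scale_right_diff_distrib zl)
    then have "g z (l *\<^sub>C x - K x) = l *\<^sub>C x"
      using g_linear by (simp add: clinear_iff g_left)
    then show "z *\<^sub>C g z (l *\<^sub>C x - K x) = x"
      by (simp add: zl)
    show "l *\<^sub>C z *\<^sub>C g z x - K (z *\<^sub>C g z x) = x"
      using g_right[of x] by (simp add: zl K.scale)
  qed
  moreover have "nb_bounded S"
    unfolding nb_bounded_def
  proof (intro conjI exI)
    show "clinear S"
      using g_linear by (simp add: clinear_iff S_def K.add K.scale cvs.scale_right_distrib mult.commute)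
    show "zero_nbhd {x. q x < 1 / M}"
      using q_nhds[of "1 / M"] M by (simp add: zero_nbhd_iff)
    have "continuous_on C (\<lambda>x. (z * z) *\<^sub>C x)"
      unfolding continuous_on_def
      by (intro ballI tendsto_scaleC tendsto_const tendsto_ident_at)
    then have "tvs_bounded ((\<lambda>x. (z * z) *\<^sub>C x) ` C)"
      by (intro compact_imp_tvs_bounded compact_continuous_image compact_C)
    moreover have "q (g z x) < 1" if "q x < 1 / M" for x
    proof -
      have "M * q x < 1"
        using that M by (simp add: field_simps)
      then show ?thesis
        using g_bound[of x] by simp
    qed
    then have "S ` {x. q x < 1 / M} \<subseteq> (\<lambda>x. (z * z) *\<^sub>C x) ` C"
      using K_ball unfolding S_def by blast
    ultimately show "tvs_bounded (S ` {x. q x < 1 / M})"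
      by (rule tvs_bounded_subset)
  qed
  ultimately show thesis
    using that by blast
qed

lemma resolvent_at_no_eigenvector:
  assumes K: "clinear K" and R: "resolvent_at K l R" and x: "K x = l *\<^sub>C x"
  shows "x = 0"
proof -
  have K0: "K 0 = 0"
    using K cvs.scale_zero_left unfolding clinear_iff by metis
  have "R (l *\<^sub>C x - K x) = x" "R (l *\<^sub>C 0 - K 0) = 0"
    using R unfolding resolvent_at_def by blast+
  then show ?thesis
    by (simp add: x K0)
qed

lemma radius_wrt_eq_spectral_modulus:
  assumes upper: "\<And>\<rho> \<nu>. 0 < \<rho> \<Longrightarrow> \<rho> < \<nu> \<Longrightarrow> (\<And>l. l \<in> E \<Longrightarrow> cmod l < \<rho>) \<Longrightarrow> null (scaled_power T \<nu>)"
    and lower: "\<And>\<nu> l. 0 < \<nu> \<Longrightarrow> null (scaled_power T \<nu>) \<Longrightarrow> l \<in> E \<Longrightarrow> cmod l \<le> \<nu>"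
  shows "radius_wrt null T = spectral_modulus E"
proof (rule antisym)
  show "radius_wrt null T \<le> spectral_modulus E"
  proof (rule ccontr)
    assume "\<not> radius_wrt null T \<le> spectral_modulus E"
    \<comment> \<open>Two intermediate values are needed, as \<rho> and \<nu> in
      \<open>upper\<close>; lying strictly between the two sides makes them positive and
      finite.\<close>
    then obtain r1 where r1: "spectral_modulus E < r1" "r1 < radius_wrt null T"
      using dense[of "spectral_modulus E" "radius_wrt null T"] by (auto simp: not_le)
    obtain r2 where r2: "r1 < r2" "r2 < radius_wrt null T"
      using dense[OF r1(2)] by blast
    obtain \<nu> where \<nu>: "0 \<le> \<nu>" "r2 = ennreal \<nu>"
      using r2(2) by (cases r2) auto
    obtain \<rho> where \<rho>: "0 \<le> \<rho>" "r1 = ennreal \<rho>"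
      using r1(2) by (cases r1) auto
    have "0 < ennreal \<rho>"
      using r1(1) unfolding \<rho>(2) by (rule order.strict_trans1[OF zero_le])
    then have \<rho>0: "0 < \<rho>"
      by simp
    have \<rho>\<nu>: "\<rho> < \<nu>"
      using r2(1) \<rho> \<nu> by (simp add: ennreal_less_iff)
    have "cmod l < \<rho>" if "l \<in> E" for l
    proof -
      have "ennreal (cmod l) \<le> spectral_modulus E"
        unfolding spectral_modulus_def using that by (rule SUP_upper)
      then have "ennreal (cmod l) < ennreal \<rho>"
        using r1(1) \<rho>(2) by simp
      then show ?thesis
        by (simp add: ennreal_less_iff)
    qed
    then have "null (scaled_power T \<nu>)"
      by (intro upper[OF \<rho>0 \<rho>\<nu>])
    then have "radius_wrt null T \<le> ennreal \<nu>"
      unfolding radius_wrt_def using \<rho>0 \<rho>\<nu> by (intro Inf_lower) auto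
    with r2(2) \<nu>(2) show False by simp
  qed
  show "spectral_modulus E \<le> radius_wrt null T"
    unfolding radius_wrt_def spectral_modulus_def
    by (rule Inf_greatest, rule SUP_least) (auto intro!: ennreal_leI lower)
qed

text \<open>The spectrum may contain 0 without 0 being an eigenvalue, but modulus 0 does not change
  a supremum in \<open>ennreal\<close>.\<close>

lemma spectral_modulus_eq:
  assumes "E \<subseteq> \<sigma>" "\<sigma> \<subseteq> insert 0 E"
  shows "spectral_modulus \<sigma> = spectral_modulus E"
proof (rule antisym)
  show "spectral_modulus E \<le> spectral_modulus \<sigma>"
    unfolding spectral_modulus_def using assms(1) by (rule SUP_subset_mono) simp
  show "spectral_modulus \<sigma> \<le> spectral_modulus E"
    unfolding spectral_modulus_def
  proof (rule SUP_least)
    fix l assume "l \<in> \<sigma>"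
    then consider "l = 0" | "l \<in> E"
      using assms(2) by blast
    then show "ennreal (cmod l) \<le> (SUP l\<in>E. ennreal (cmod l))"
      by cases (auto intro: SUP_upper)
  qed
qed

theorem corollary7p3:
  fixes K :: "'a::complex_tvs \<Rightarrow> 'a"
  assumes "locally_convex TYPE('a) \<or> locally_pseudo_convex TYPE('a)"
    and "compact_operator K"
  shows "\<forall>r \<in> {radius_bb K, radius_c K, radius_nn K, radius_nb K}.
         \<forall>\<sigma> \<in> {spectrum_bb K, spectrum_c K, spectrum_nn K, spectrum_nb K}.
           r = spectral_modulus \<sigma>"
proof -
  \<comment> \<open>Convex sets are pseudo-convex, so both alternatives provide a standing base with
    pseudo-convex members.\<close>
  obtain N :: "'a set set" where N: "zero_base N" and pconvex: "\<And>U. U \<in> N \<Longrightarrow> pseudo_convex U"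
    using assms(1) convex_imp_pseudo_convex
    unfolding locally_pseudo_convex_def zero_base_def locally_convex_def by metis
  obtain U0 where K: "clinear K" and U0: "zero_nbhd U0" "compact (closure (K ` U0))"
    using assms(2) unfolding compact_operator_def by blast
  have general: "zero_base_general N"
    using N by (simp add: zero_base_def)
  obtain U where U: "U \<in> N" "U \<subseteq> U0"
    using general U0(1) unfolding zero_base_general_def by blast
  have nbhd: "zero_nbhd U" and bal: "cbalanced U"
    using general U(1) unfolding zero_base_general_def by blast+
  obtain a :: real where a: "1 \<le> a"
    "\<And>b x y. a \<le> b \<Longrightarrow> x \<in> U \<Longrightarrow> y \<in> U \<Longrightarrow> inverse b *\<^sub>R (x + y) \<in> U"
    using pseudo_convexE[OF bal pconvex[OF U(1)]] by blast
  interpret quasi_seminorm "minkowski_gauge U" a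
    using nbhd bal a(1) a(2)[OF order_refl] by (rule quasi_seminorm_gauge)
  interpret K: Vector_Spaces.linear scaleC scaleC K
    by (rule K)
  interpret compact_on_ball "minkowski_gauge U" a K "closure (K ` U0)"
  proof
    show "compact (closure (K ` U0))" by (rule U0(2))
    show "K x \<in> closure (K ` U0)" if "minkowski_gauge U x < 1" for x
      using gauge_less(2)[OF nbhd bal that] U(2) closure_subset by fastforce
    show "\<forall>\<^sub>F x in nhds 0. minkowski_gauge U x < e" if e: "0 < e" for e
    proof -
      have "zero_nbhd ((\<lambda>x. (e / 2) *\<^sub>R x) ` U)"
        using nbhd e by (intro zero_nbhd_scaleR) auto
      then show ?thesis
        unfolding zero_nbhd_iff
      proof eventually_elim
        case (elim x)
        then have "minkowski_gauge U x \<le> e / 2"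
          using e by (intro gauge_le) (auto simp: mem_scaleR_image)
        then show ?case using e by simp
      qed
    qed
  qed
  have gauge_le_1: "minkowski_gauge U x \<le> 1" if "x \<in> U" for x
    by (rule gauge_le) (simp_all add: that)
  define E where "E = {l. \<exists>x. x \<noteq> 0 \<and> K x = l *\<^sub>C x}"
  have eigen: "l \<notin> E" if "resolvent_at K l R" for l R
    using resolvent_at_no_eigenvector[OF K that] by (auto simp: E_def)
  have nb: "\<exists>S. nb_bounded S \<and> resolvent_at K l (\<lambda>x. inverse l *\<^sub>C x + S x)"
    if "l \<noteq> 0" "l \<notin> E" for l
    using that by (auto simp: E_def intro: nb_resolvent_exists)
  have nn: "\<exists>R. resolvent_at K l R \<and> nn_bounded R" if "l \<noteq> 0" "l \<notin> E" for l
    using nb[OF that] nn_bounded_scalar_plus_nb[OF N pconvex] by blast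
  \<comment> \<open>An nn-bounded resolvent is also bb-bounded and continuous, so the nn and nb
    cases settle all four spectra.\<close>
  have spectra: "spectral_modulus \<sigma> = spectral_modulus E"
    if "\<sigma> \<in> {spectrum_bb K, spectrum_c K, spectrum_nn K, spectrum_nb K}" for \<sigma>
  proof (rule spectral_modulus_eq)
    show "E \<subseteq> \<sigma>"
      using that eigen
      by (auto simp: spectrum_bb_def spectrum_c_def spectrum_nn_def spectrum_nb_def)
    show "\<sigma> \<subseteq> insert 0 E"
      using that nb nn nn_bounded_imp_bb_bounded nn_bounded_imp_c_bounded
      unfolding spectrum_bb_def spectrum_c_def spectrum_nn_def spectrum_nb_def by blast
  qed
  note lin = clinear_scaled_power[OF K]
  \<comment> \<open>The common source of all upper bounds: it gives null convergence in the nb-sense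
    directly and in the nn-sense by the adapted base, and from there in the c- and
    bb-senses.\<close>
  have null: "null_uniformly_on U (scaled_power K \<nu>)"
    if "0 < \<rho>" "\<rho> < \<nu>" "\<And>l. l \<in> E \<Longrightarrow> cmod l < \<rho>" for \<rho> \<nu>
    unfolding null_uniformly_on_def
  proof (intro allI impI)
    fix V :: "'a set" assume "zero_nbhd V"
    have "\<forall>\<^sub>F n in sequentially. \<forall>x. minkowski_gauge U x \<le> 1 \<longrightarrow> scaled_power K \<nu> n x \<in> V"
    proof (rule scaled_power_tendsto_zero[OF that(1,2) _ \<open>zero_nbhd V\<close>])
      show "x = 0" if "\<rho> \<le> cmod l" "K x = l *\<^sub>C x" for l x
        using \<open>\<And>l. l \<in> E \<Longrightarrow> cmod l < \<rho>\<close>[of l] that by (auto simp: E_def)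
    qed
    then show "\<forall>\<^sub>F n in sequentially. scaled_power K \<nu> n ` U \<subseteq> V"
      by eventually_elim (auto simp: gauge_le_1)
  qed
  have null_nn: "null_nn (scaled_power K \<nu>)"
    if "0 < \<rho>" "\<rho> < \<nu>" "\<And>l. l \<in> E \<Longrightarrow> cmod l < \<rho>" for \<rho> \<nu>
    by (rule null_nn_of_null_uniformly_on[OF N U(1) lin null[OF that]])
  \<comment> \<open>The common source of all lower bounds, since each of the other three notions
    implies \<open>null_bb\<close>.\<close>
  have bb: "cmod l \<le> \<nu>" if "0 < \<nu>" "null_bb (scaled_power K \<nu>)" "l \<in> E" for l \<nu>
    using that eigenvalue_le_of_null_bb[OF K] by (auto simp: E_def)
  have null_c_bb: "null_bb (scaled_power K \<nu>)" if "null_c (scaled_power K \<nu>)" for \<nu>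
    using lin that by (rule null_c_imp_null_bb)
  have "radius_nb K = spectral_modulus E"
    unfolding radius_nb_def
  proof (rule radius_wrt_eq_spectral_modulus)
    show "null_nb (scaled_power K \<nu>)"
      if "0 < \<rho>" "\<rho> < \<nu>" "\<And>l. l \<in> E \<Longrightarrow> cmod l < \<rho>" for \<rho> \<nu>
      using null[OF that] nbhd unfolding null_nb_def by blast
  qed (rule bb[OF _ null_nb_imp_null_bb[OF lin]])
  moreover have "radius_nn K = spectral_modulus E"
    unfolding radius_nn_def
    by (rule radius_wrt_eq_spectral_modulus, rule null_nn)
      (assumption | rule bb[OF _ null_c_bb[OF null_nn_imp_null_c]])+
  moreover have "radius_c K = spectral_modulus E"
    unfolding radius_c_def
    by (rule radius_wrt_eq_spectral_modulus, rule null_nn_imp_null_c[OF null_nn])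
      (assumption | rule bb[OF _ null_c_bb])+
  moreover have "radius_bb K = spectral_modulus E"
    unfolding radius_bb_def
    by (rule radius_wrt_eq_spectral_modulus, rule null_c_bb[OF null_nn_imp_null_c[OF null_nn]])
      (assumption | rule bb)+
  ultimately show ?thesis
    using spectra by auto
qed

end
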